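(* Assume (A1) and (A2) of the context. Let $\{M_{X_k}\}$ be the sequence of normal matrices generated by the primal interior point method described in the context, and suppose that $\delta(x_k,\mu_k)\le\frac{\sqrt2}{2}$ for all $k=1,2,\dots$ and $\mu_{k+1}=(1-\tau)\mu_k$ with $\tau\in(0,1/\sqrt{2n}]$. Then $$\kappa\big(M_{X_k}^{-1/2}M_{X_j}M_{X_k}^{-1/2}\big)\le 9$$ for all $j\ge k\ge k^\star$, where $$k^\star:=\min\Big\{k:\ \mu_k\le \frac{\sqrt{\lambda^\star}\,\tau}{16\,\gamma\,\|A\|}\cdot\Big(1+\frac{\|A_{\mathcal N}\|}{\sqrt{\lambda_{\min}(A_{\mathcal B}^\top A_{\mathcal B})}}\Big)^{-1}\Big\},\qquad \lambda^\star:=\lambda_{\min}(M_{X^\star}).$$ In particular, choosing $\tau=1/\sqrt{2n}$ gives $$k^\star=\mathcal{O}\Big(\sqrt n\,\Big[\log\Big(\frac{\gamma\|A\|}{\sqrt{\lambda^\star}}\Big)+\log\Big(1+\frac{\|A_{\mathcal N}\|}{\sqrt{\lambda_{\min}(A_{\mathcal B}^\top A_{\mathcal B})}}\Big)\Big]\Big).$$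
   Context: Let $A\in\mathbb{R}^{m\times n}$, $b\in\mathbb{R}^m$, $c\in\mathbb{R}^n$. Primal LP: minimize $\langle c,x\rangle$ subject to $Ax=b$, $x\ge 0$. Dual LP: maximize $\langle b,y\rangle$ subject to $A^\top y+s=c$, $s\ge0$. $\mathcal{F}_p=\{x: Ax=b,\ x\ge0\}$, $\mathcal{F}_d=\{(y,s):A^\top y+s=c,\ s\ge0\}$; $\mathcal{F}_p^0,\mathcal{F}_d^0$ are the subsets where $x>0$, respectively $s>0$. $X=\mathrm{diag}(x)$ (similarly $X_k=\mathrm{diag}(x_k)$, $X^\star=\mathrm{diag}(x^\star)$), $e$ is the all-ones vector, $\|\cdot\|$ is the Euclidean norm or matrix operator norm. The primal normal matrix is $M_X=AX^2A^\top$. $\kappa(M)=\lambda_{\max}(M)/\lambda_{\min}(M)$ for symmetric positive definite $M$. $A_{\mathcal B}$, $A_{\mathcal N}$ are the column submatrices of $A$ indexed by $\mathcal B$, $\mathcal N$. Proximity measure: for $x\in\mathcal{F}_p^0$, $\mu>0$, $\delta(x,\mu):=\min_{(y,s)\in\mathcal{F}_d}\|\frac1\mu Xs-e\|=\|P_{AX}(\frac1\mu Xc-e)\|$, where $P_{AX}=I-XA^\top(AX^2A^\top)^{-1}AX$. Maximal complementarity partition: $\mathcal{B}=\{j: x_j^\star>0$ for some $x^\star\}$, $\mathcal{N}=\{j:s_j^\star>0$ for some $s^\star\}$, where $(x^\star,s^\star)$ ranges over optimal primal-dual solution pairs; under (A1), $\mathcal B\cup\mathcal N=\{1,\dots,n\}$,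 $\mathcal B\cap\mathcal N=\varnothing$, and there is a strictly complementary optimal pair ($x^\star+s^\star>0$). For an arbitrarily chosen strictly complementary solution $(x^\star,s^\star)$, set $\gamma:=n/\min_{j\in\mathcal N}s_j^\star>0$. (A1): $\mathcal{F}_p^0$ and $\mathcal{F}_d^0$ are nonempty and $A$ has full row rank. (A2): the primal problem is non-degenerate; the maximal complementarity partition satisfies $|\mathcal{B}|=m$. Given (A2), the primal optimal solution $x^\star$ is unique. Primal interior point method: start from $x_1\in\mathcal{F}_p^0$, $\mu_1>0$, $\tau\in(0,1)$. For $k=1,2,\dots$: compute $\Delta x_k=-X_kP_{AX_k}(\frac1{\mu_k}X_kc-e)$; choose $\alpha_k\in(0,1)$ such that $x_k+\alpha_k\Delta x_k\in\mathcal{F}_p^0$; set $x_{k+1}=x_k+\alpha_k\Delta x_k$ and $\mu_{k+1}=(1-\tau)\mu_k$.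
   Formalization: The O-bound on k* is false with one constant (let mu_1 grow, or scale c so the bracket is <= 0); it is stated when 1, log n and log mu_1 are at most K times the bracket, with a constant depending only on K. The set N is assumed nonempty so that gamma is defined. *)

theory Defs
  imports
    Complex_Main
    "Jordan_Normal_Form.Spectral_Radius"
    "Jordan_Normal_Form.Gauss_Jordan_Elimination"
    "Jordan_Normal_Form.DL_Rank"
    "Jordan_Normal_Form.DL_Submatrix"
begin

text \<open>Matrices and vectors have explicit dimensions (rather than dimensions as types), so that the
constant of the complexity estimate can be quantified before the dimensions, and so that the column
submatrices are genuine matrices. Indices run from \<open>0\<close> to \<open>n - 1\<close>.\<close>

definition vnorm :: "real vec \<Rightarrow> real" where
  "vnorm v = sqrt (v \<bullet> v)"

definition op_norm :: "real mat \<Rightarrow> real" where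
  "op_norm M = (SUP v \<in> {v \<in> carrier_vec (dim_col M). vnorm v \<le> 1}. vnorm (M *\<^sub>v v))"

text \<open>These and \<open>kappa\<close> are meant for symmetric matrices of positive dimension, whose spectrum is a finite
nonempty set of reals.\<close>

definition lambda_min :: "real mat \<Rightarrow> real" where
  "lambda_min M = Min (spectrum M)"

definition lambda_max :: "real mat \<Rightarrow> real" where
  "lambda_max M = Max (spectrum M)"

definition kappa :: "real mat \<Rightarrow> real" where
  "kappa M = lambda_max M / lambda_min M"

text \<open>Only applied to invertible matrices.\<close>

definition minv :: "real mat \<Rightarrow> real mat" where
  "minv M = the (mat_inverse M)"

definition sym_psd :: "real mat \<Rightarrow> bool" where
  "sym_psd M \<longleftrightarrow> dim_row M = dim_col M \<and> transpose_mat M = M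
     \<and> (\<forall>v \<in> carrier_vec (dim_col M). v \<bullet> (M *\<^sub>v v) \<ge> 0)"

definition mat_sqrt :: "real mat \<Rightarrow> real mat" where
  "mat_sqrt M = (THE R. sym_psd R \<and> R * R = M)"

definition inv_sqrt :: "real mat \<Rightarrow> real mat" where
  "inv_sqrt M = minv (mat_sqrt M)"

definition diag_of :: "real vec \<Rightarrow> real mat" where
  "diag_of x = mat_diag (dim_vec x) (\<lambda>i. x $ i)"

definition ones :: "nat \<Rightarrow> real vec" where
  "ones n = vec n (\<lambda>_. 1)"

definition colsub :: "real mat \<Rightarrow> nat set \<Rightarrow> real mat" where
  "colsub A J = submatrix A UNIV J"

definition normal_mat :: "real mat \<Rightarrow> real vec \<Rightarrow> real mat" where
  "normal_mat A x = A * (diag_of x * diag_of x) * transpose_mat A"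

definition proj_AX :: "real mat \<Rightarrow> real vec \<Rightarrow> real mat" where
  "proj_AX A x = 1\<^sub>m (dim_col A)
     - diag_of x * transpose_mat A * minv (normal_mat A x) * A * diag_of x"

definition Fp :: "real mat \<Rightarrow> real vec \<Rightarrow> real vec set" where
  "Fp A b = {x \<in> carrier_vec (dim_col A). A *\<^sub>v x = b \<and> (\<forall>j < dim_col A. x $ j \<ge> 0)}"

definition Fp0 :: "real mat \<Rightarrow> real vec \<Rightarrow> real vec set" where
  "Fp0 A b = {x \<in> Fp A b. \<forall>j < dim_col A. x $ j > 0}"

definition Fd :: "real mat \<Rightarrow> real vec \<Rightarrow> (real vec \<times> real vec) set" where
  "Fd A c = {(y, s). y \<in> carrier_vec (dim_row A) \<and> s \<in> carrier_vec (dim_col A)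
     \<and> transpose_mat A *\<^sub>v y + s = c \<and> (\<forall>j < dim_col A. s $ j \<ge> 0)}"

definition Fd0 :: "real mat \<Rightarrow> real vec \<Rightarrow> (real vec \<times> real vec) set" where
  "Fd0 A c = {(y, s) \<in> Fd A c. \<forall>j < dim_col A. s $ j > 0}"

definition primal_optimal :: "real mat \<Rightarrow> real vec \<Rightarrow> real vec \<Rightarrow> real vec set" where
  "primal_optimal A b c = {x \<in> Fp A b. \<forall>x' \<in> Fp A b. c \<bullet> x \<le> c \<bullet> x'}"

definition dual_optimal :: "real mat \<Rightarrow> real vec \<Rightarrow> real vec \<Rightarrow> (real vec \<times> real vec) set" where
  "dual_optimal A b c = {(y, s) \<in> Fd A c. \<forall>(y', s') \<in> Fd A c. b \<bullet> y' \<le> b \<bullet> y}"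

definition optimal_pairs :: "real mat \<Rightarrow> real vec \<Rightarrow> real vec \<Rightarrow> (real vec \<times> real vec) set" where
  "optimal_pairs A b c = {(x, s). x \<in> primal_optimal A b c \<and> (\<exists>y. (y, s) \<in> dual_optimal A b c)}"

definition part_B :: "real mat \<Rightarrow> real vec \<Rightarrow> real vec \<Rightarrow> nat set" where
  "part_B A b c = {j. j < dim_col A \<and> (\<exists>(x, s) \<in> optimal_pairs A b c. x $ j > 0)}"

definition part_N :: "real mat \<Rightarrow> real vec \<Rightarrow> real vec \<Rightarrow> nat set" where
  "part_N A b c = {j. j < dim_col A \<and> (\<exists>(x, s) \<in> optimal_pairs A b c. s $ j > 0)}"

definition strictly_complementary ::
    "real mat \<Rightarrow> real vec \<Rightarrow> real vec \<Rightarrow> real vec \<Rightarrow> real vec \<Rightarrow> bool" where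
  "strictly_complementary A b c x s \<longleftrightarrow>
     (x, s) \<in> optimal_pairs A b c \<and> (\<forall>j < dim_col A. x $ j + s $ j > 0)"

definition supp :: "real vec \<Rightarrow> nat set" where
  "supp x = {j. j < dim_vec x \<and> x $ j \<noteq> 0}"

text \<open>A feasible point is basic iff the columns of \<open>A\<close> in its support are linearly independent.\<close>

definition basic_feasible :: "real mat \<Rightarrow> real vec \<Rightarrow> real vec \<Rightarrow> bool" where
  "basic_feasible A b x \<longleftrightarrow>
     x \<in> Fp A b \<and> vec_space.rank (dim_row A) (colsub A (supp x)) = card (supp x)"

text \<open>Degeneracy is excluded only for the optimal basic solutions. This is implied by the textbook
condition that every basic feasible solution has exactly \<open>m\<close> positive components. The condition
\<open>card B = m\<close> in \<open>A2\<close> does not imply it: in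
\<open>min x3 + x4\<close> subject to \<open>x1 + x2 = 1\<close>, \<open>x3 - x4 = 0\<close>, \<open>x \<ge> 0\<close> one has
\<open>card B = m = 2\<close>, but a singular \<open>A_B\<close> and a nonunique optimal solution.\<close>

definition primal_nondegenerate :: "real mat \<Rightarrow> real vec \<Rightarrow> real vec \<Rightarrow> bool" where
  "primal_nondegenerate A b c \<longleftrightarrow>
     (\<forall>x \<in> primal_optimal A b c. basic_feasible A b x \<longrightarrow> card (supp x) = dim_row A)"

definition A1 :: "real mat \<Rightarrow> real vec \<Rightarrow> real vec \<Rightarrow> bool" where
  "A1 A b c \<longleftrightarrow> Fp0 A b \<noteq> {} \<and> Fd0 A c \<noteq> {} \<and> vec_space.rank (dim_row A) A = dim_row A"

definition A2 :: "real mat \<Rightarrow> real vec \<Rightarrow> real vec \<Rightarrow> bool" where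
  "A2 A b c \<longleftrightarrow> primal_nondegenerate A b c \<and> card (part_B A b c) = dim_row A"

definition gam :: "real mat \<Rightarrow> real vec \<Rightarrow> real vec \<Rightarrow> real vec \<Rightarrow> real" where
  "gam A b c ss = real (dim_col A) / Min ((\<lambda>j. ss $ j) ` part_N A b c)"

text \<open>The infimum is attained, the dual feasible set being a nonempty polyhedron.\<close>

definition delta :: "real mat \<Rightarrow> real vec \<Rightarrow> real vec \<Rightarrow> real \<Rightarrow> real" where
  "delta A c x \<mu> =
     (INF (y, s) \<in> Fd A c. vnorm ((1 / \<mu>) \<cdot>\<^sub>v (diag_of x *\<^sub>v s) - ones (dim_col A)))"

definition newton_dir :: "real mat \<Rightarrow> real vec \<Rightarrow> real vec \<Rightarrow> real \<Rightarrow> real vec" where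
  "newton_dir A c x \<mu> =
     - (diag_of x *\<^sub>v (proj_AX A x *\<^sub>v ((1 / \<mu>) \<cdot>\<^sub>v (diag_of x *\<^sub>v c) - ones (dim_col A))))"

text \<open>Iterates are indexed from 1; the values of the sequences at 0 are irrelevant.\<close>

definition primal_ipm ::
    "real mat \<Rightarrow> real vec \<Rightarrow> real vec \<Rightarrow> real \<Rightarrow> (nat \<Rightarrow> real vec) \<Rightarrow> (nat \<Rightarrow> real) \<Rightarrow> bool" where
  "primal_ipm A b c \<tau> x \<mu> \<longleftrightarrow>
     x 1 \<in> Fp0 A b \<and> \<mu> 1 > 0 \<and> 0 < \<tau> \<and> \<tau> < 1 \<and>
     (\<forall>k \<ge> 1.
        (\<exists>\<alpha>. 0 < \<alpha> \<and> \<alpha> < 1 \<and> x (Suc k) = x k + \<alpha> \<cdot>\<^sub>v newton_dir A c (x k) (\<mu> k)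
             \<and> x (Suc k) \<in> Fp0 A b) \<and>
        \<mu> (Suc k) = (1 - \<tau>) * \<mu> k)"

definition imbalance :: "real mat \<Rightarrow> real vec \<Rightarrow> real vec \<Rightarrow> real" where
  "imbalance A b c =
     1 + op_norm (colsub A (part_N A b c))
         / sqrt (lambda_min (transpose_mat (colsub A (part_B A b c)) * colsub A (part_B A b c)))"

definition kstar ::
    "real mat \<Rightarrow> real vec \<Rightarrow> real vec \<Rightarrow> real vec \<Rightarrow> real vec \<Rightarrow> real \<Rightarrow> (nat \<Rightarrow> real) \<Rightarrow> nat" where
  "kstar A b c xs ss \<tau> \<mu> =
     (LEAST k. 1 \<le> k \<and>
        \<mu> k \<le> sqrt (lambda_min (normal_mat A xs)) * \<tau> / (16 * gam A b c ss * op_norm A)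
               * inverse (imbalance A b c))"

text \<open>A run of the method in the standing setting. \<open>part_N \<noteq> {}\<close> is needed for \<open>gam\<close>, a minimum over
\<open>part_N\<close>, to be defined; under \<open>A2\<close> it excludes only \<open>n = m\<close>, where \<open>Fp\<close> is a single point.\<close>

definition ipm_run ::
    "nat \<Rightarrow> nat \<Rightarrow> real mat \<Rightarrow> real vec \<Rightarrow> real vec \<Rightarrow> real vec \<Rightarrow> real vec
      \<Rightarrow> real \<Rightarrow> (nat \<Rightarrow> real vec) \<Rightarrow> (nat \<Rightarrow> real) \<Rightarrow> bool" where
  "ipm_run m n A b c xs ss \<tau> x \<mu> \<longleftrightarrow>
     m \<ge> 1 \<and> n \<ge> 1 \<and> A \<in> carrier_mat m n \<and> b \<in> carrier_vec m \<and> c \<in> carrier_vec n \<and>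
     A1 A b c \<and> A2 A b c \<and> part_N A b c \<noteq> {} \<and>
     strictly_complementary A b c xs ss \<and>
     primal_ipm A b c \<tau> x \<mu> \<and>
     (\<forall>k \<ge> 1. delta A c (x k) (\<mu> k) \<le> sqrt 2 / 2)"

text \<open>The bracket of the complexity estimate.\<close>

definition log_cond :: "real mat \<Rightarrow> real vec \<Rightarrow> real vec \<Rightarrow> real vec \<Rightarrow> real vec \<Rightarrow> real" where
  "log_cond A b c xs ss =
     ln (gam A b c ss * op_norm A / sqrt (lambda_min (normal_mat A xs))) + ln (imbalance A b c)"

text \<open>The range in which the estimate \<open>kstar = O (sqrt n * log_cond)\<close> is read. With \<open>\<tau> = 1 / sqrt (2 * n)\<close>,
\<open>kstar\<close> is about \<open>sqrt (2 * n) * (log_cond + ln (\<mu> 1) + ln (16 * sqrt (2 * n)))\<close>; the O-estimate absorbs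
\<open>ln (\<mu> 1)\<close>, \<open>ln n\<close> and additive constants into \<open>log_cond\<close>, which presupposes that they are bounded by a
multiple \<open>K\<close> of it. The hidden constant depends on \<open>K\<close> only. For fixed \<open>n\<close> and \<open>\<mu> 1\<close> and any
\<open>\<epsilon> > 0\<close>, a suitable \<open>K\<close> covers all runs with \<open>log_cond \<ge> \<epsilon>\<close>.\<close>

definition O_range :: "real \<Rightarrow> nat \<Rightarrow> real \<Rightarrow> real \<Rightarrow> bool" where
  "O_range K n \<mu>1 L \<longleftrightarrow> 1 \<le> K * L \<and> ln (real n) \<le> K * L \<and> ln \<mu>1 \<le> K * L"

end

theory Submission
  imports Defs "HOL-Analysis.L2_Norm"
begin

text \<open>Since \<open>\<delta> < 1\<close>, the iterates have duality gap at most \<open>2 n \<mu>\<^sub>k\<close>. Hence the coordinates in \<open>\<N>\<close> of \<open>x\<^sub>k\<close> have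
norm at most \<open>2 \<gamma> \<mu>\<^sub>k\<close>, and \<open>A x\<^sub>k = A x\<^sup>\<star>\<close> with \<open>A\<^sub>\<B>\<close> invertible bounds \<open>\<parallel>x\<^sub>k - x\<^sup>\<star>\<parallel>\<close> by this times
\<open>1 + \<parallel>A\<^sub>\<N>\<parallel> / \<sigma>\<^sub>m\<^sub>i\<^sub>n(A\<^sub>\<B>)\<close>. From \<open>k\<^sup>\<star>\<close> on, \<open>\<parallel>A\<parallel> \<parallel>x\<^sub>k - x\<^sup>\<star>\<parallel> \<le> \<surd>\<lambda>\<^sup>\<star> / 8\<close>, so that \<open>\<parallel>X\<^sub>k A\<^sup>T v\<parallel>\<close> lies
between \<open>7/8\<close> and \<open>9/8\<close> of \<open>\<parallel>X\<^sup>\<star> A\<^sup>T v\<parallel>\<close> for every \<open>v\<close>. All these normal matrices are thus comparable, and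
the condition number is at most \<open>(9/7)\<^sup>4 < 9\<close>.\<close>

section \<open>Quadratic forms and extreme eigenvalues\<close>

text \<open>Spectra enter only through quadratic forms: if a v.Mv \<le> v.Nv \<le> b v.Mv for all v,
  then M^{-1/2} N M^{-1/2} has condition number at most b/a. Turning this into a statement about
  \<open>kappa\<close> and \<open>inv_sqrt\<close> requires that the extreme Rayleigh quotients be
  eigenvalues, and that the description in \<open>mat_sqrt\<close> denote something: a positive
  semidefinite root must be shown to exist and to be unique. On the optimization side the obstacle
  is the invertibility of A_B, which |B| = m alone does not give. It comes from the nondegeneracy of
  a basic optimal solution, and finding one by support reduction uses complementarity between
  optimal primal and dual solutions. The method itself supplies that, since its duality gaps vanish.
  The constant 16 in \<open>kstar\<close> is 2 * 8: the 2 cancels the factor in 2 \<gamma> \<mu>,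
  and the 8, together with \<tau> < 1, leaves an error of at most 1/8 relative to the smallest
  singular value of the optimal diagonal scaling times A^T.\<close>

lemma vnorm_eq_L2_set: "vnorm v = L2_set (($) v) {0..<dim_vec v}"
  by (simp add: vnorm_def L2_set_def scalar_prod_def power2_eq_square)

lemma scalar_prod_self_nonneg: "0 \<le> v \<bullet> (v :: real vec)"
  by (simp add: scalar_prod_def sum_nonneg)

lemma scalar_prod_self_pos:
  assumes "v \<in> carrier_vec n" "v \<noteq> 0\<^sub>v n"
  shows "0 < v \<bullet> (v :: real vec)"
proof -
  obtain i where "i < n" "v $ i \<noteq> 0"
    using assms by (metis carrier_vecD eq_vecI index_zero_vec)
  then have "0 < (\<Sum>i\<in>{0..<dim_vec v}. v $ i * v $ i)"
    using assms by (intro sum_pos2[of _ i]) (auto simp: zero_less_mult_iff)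
  then show ?thesis
    by (simp add: scalar_prod_def)
qed

lemma vnorm_nonneg: "0 \<le> vnorm v"
  by (simp add: vnorm_def scalar_prod_self_nonneg)

lemma vnorm_power2: "(vnorm v)\<^sup>2 = v \<bullet> v"
  by (simp add: vnorm_def scalar_prod_self_nonneg)

lemma vnorm_smult: "vnorm (a \<cdot>\<^sub>v v) = \<bar>a\<bar> * vnorm v"
proof -
  have "(a \<cdot>\<^sub>v v) \<bullet> (a \<cdot>\<^sub>v v) = a\<^sup>2 * (v \<bullet> v)"
    by (simp add: power2_eq_square)
  then show ?thesis
    by (simp add: vnorm_def real_sqrt_mult)
qed

lemma vnorm_triangle:
  assumes "u \<in> carrier_vec n" "v \<in> carrier_vec n"
  shows "vnorm (u + v) \<le> vnorm u + vnorm v"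
proof -
  have "vnorm (u + v) = L2_set (\<lambda>i. u $ i + v $ i) {0..<n}"
    using assms by (auto simp: vnorm_eq_L2_set intro!: L2_set_cong)
  then show ?thesis
    using L2_set_triangle_ineq[of "($) u" "($) v" "{0..<n}"] assms by (simp add: vnorm_eq_L2_set)
qed

lemma scalar_prod_le_vnorm:
  assumes "u \<in> carrier_vec n" "v \<in> carrier_vec n"
  shows "\<bar>u \<bullet> v\<bar> \<le> vnorm u * vnorm v"
proof -
  have "\<bar>u \<bullet> v\<bar> \<le> (\<Sum>i\<in>{0..<n}. \<bar>u $ i\<bar> * \<bar>v $ i\<bar>)"
    using assms by (auto simp: scalar_prod_def abs_mult intro!: order.trans[OF sum_abs])
  also have "\<dots> \<le> vnorm u * vnorm v"
    using L2_set_mult_ineq[of "($) u" "($) v" "{0..<n}"] assms by (simp add: vnorm_eq_L2_set)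
  finally show ?thesis .
qed

lemma abs_index_le_vnorm:
  assumes "i < dim_vec v"
  shows "\<bar>v $ i\<bar> \<le> vnorm v"
  using member_le_L2_set[of "{0..<dim_vec v}" i "\<lambda>i. \<bar>v $ i\<bar>"] assms
  by (simp add: vnorm_eq_L2_set L2_set_def)

lemma vnorm_le_sum:
  assumes "\<And>i. i < dim_vec v \<Longrightarrow> 0 \<le> v $ i"
  shows "vnorm v \<le> (\<Sum>i\<in>{0..<dim_vec v}. v $ i)"
  unfolding vnorm_eq_L2_set by (rule L2_set_le_sum) (use assms in auto)

section \<open>Bounded, semidefinite and definite quadratic forms\<close>

lemma quad_form_bound:
  fixes M :: "real mat"
  assumes M: "M \<in> carrier_mat n n"
  shows "\<exists>C>0. \<forall>v\<in>carrier_vec n. v \<bullet> (M *\<^sub>v v) \<le> C * (v \<bullet> v)"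
proof -
  define C where "C = (\<Sum>i<n. \<Sum>j<n. \<bar>M $$ (i, j)\<bar>)"
  \<comment> \<open>The added 1 makes the constant positive even for M = 0, so that its reciprocal
    can be taken later.\<close>
  have "v \<bullet> (M *\<^sub>v v) \<le> (C + 1) * (v \<bullet> v)" if v: "v \<in> carrier_vec n" for v
  proof -
    have le: "\<bar>v $ i\<bar> \<le> vnorm v" if "i < n" for i
      using abs_index_le_vnorm[of i v] v that by simp
    have "v \<bullet> (M *\<^sub>v v) = (\<Sum>i<n. \<Sum>j<n. M $$ (i, j) * (v $ i * v $ j))"
      using M v by (auto simp: scalar_prod_def sum_distrib_left lessThan_atLeast0 algebra_simps
          intro!: sum.cong)
    also have "\<dots> \<le> (\<Sum>i<n. \<Sum>j<n. \<bar>M $$ (i, j)\<bar> * (vnorm v * vnorm v))"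
    proof (intro sum_mono)
      fix i j assume "i \<in> {..<n}" "j \<in> {..<n}"
      then have "\<bar>v $ i\<bar> * \<bar>v $ j\<bar> \<le> vnorm v * vnorm v"
        by (intro mult_mono le) (auto simp: vnorm_nonneg)
      then have "\<bar>M $$ (i, j)\<bar> * (\<bar>v $ i\<bar> * \<bar>v $ j\<bar>) \<le> \<bar>M $$ (i, j)\<bar> * (vnorm v * vnorm v)"
        by (rule mult_left_mono) simp
      then show "M $$ (i, j) * (v $ i * v $ j) \<le> \<bar>M $$ (i, j)\<bar> * (vnorm v * vnorm v)"
        using abs_ge_self[of "M $$ (i, j) * (v $ i * v $ j)"] by (simp add: abs_mult)
    qed
    also have "\<dots> = C * (v \<bullet> v)"
      by (simp add: C_def sum_distrib_right flip: vnorm_power2 power2_eq_square)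
    also have "\<dots> \<le> (C + 1) * (v \<bullet> v)"
      by (simp add: mult_right_mono scalar_prod_self_nonneg)
    finally show ?thesis .
  qed
  moreover have "0 \<le> C"
    by (simp add: C_def sum_nonneg)
  ultimately show ?thesis
    by (intro exI[of _ "C + 1"]) auto
qed

lemma quad_form_perturb:
  fixes M :: "real mat"
  assumes M: "M \<in> carrier_mat n n" "transpose_mat M = M"
    and v: "u \<in> carrier_vec n" "v \<in> carrier_vec n"
  shows "(u + t \<cdot>\<^sub>v v) \<bullet> (M *\<^sub>v (u + t \<cdot>\<^sub>v v))
    = u \<bullet> (M *\<^sub>v u) + 2 * t * (u \<bullet> (M *\<^sub>v v)) + t\<^sup>2 * (v \<bullet> (M *\<^sub>v v))"
proof -
  have "v \<bullet> (M *\<^sub>v u) = u \<bullet> (M *\<^sub>v v)"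
    using transpose_vec_mult_scalar[OF M(1) v] M v comm_scalar_prod[of "M *\<^sub>v v" n u] by simp
  moreover have "M *\<^sub>v (u + t \<cdot>\<^sub>v v) = M *\<^sub>v u + t \<cdot>\<^sub>v (M *\<^sub>v v)"
    using M v by (simp add: mult_add_distrib_mat_vec mult_mat_vec)
  ultimately show ?thesis
    using M v
    by (simp add: add_scalar_prod_distrib[of _ n] scalar_prod_add_distrib[of _ n] algebra_simps
        power2_eq_square)
qed

text \<open>The form is nonnegative at u + t v for every real t, and a quadratic in t that never
  becomes negative has nonpositive discriminant. If v.Mv = 0, the polynomial is affine in t and
  hence must be constant.\<close>

lemma psd_Cauchy_Schwarz:
  assumes M: "M \<in> carrier_mat n n" "sym_psd M"
    and v: "u \<in> carrier_vec n" "v \<in> carrier_vec n"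
  shows "(u \<bullet> (M *\<^sub>v v))\<^sup>2 \<le> (u \<bullet> (M *\<^sub>v u)) * (v \<bullet> (M *\<^sub>v v))"
proof -
  let ?a = "u \<bullet> (M *\<^sub>v u)" and ?b = "u \<bullet> (M *\<^sub>v v)" and ?c = "v \<bullet> (M *\<^sub>v v)"
  have pos: "0 \<le> w \<bullet> (M *\<^sub>v w)" if "w \<in> carrier_vec n" for w
    using M that by (auto simp: sym_psd_def)
  have q: "0 \<le> ?a + 2 * t * ?b + t\<^sup>2 * ?c" for t
    using pos[of "u + t \<cdot>\<^sub>v v"] quad_form_perturb[of M n u v t] M v by (auto simp: sym_psd_def)
  show ?thesis
  proof (cases "?c = 0")
    case True
    have "?b = 0"
    proof (rule ccontr)
      assume "?b \<noteq> 0"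
      \<comment> \<open>At this t the affine polynomial has the value -1.\<close>
      then show False
        using q[of "- (?a + 1) / (2 * ?b)"] True by (simp add: field_simps)
    qed
    then show ?thesis
      using True by simp
  next
    case False
    with pos[OF v(2)] have "0 < ?c" by simp
    then show ?thesis
      using q[of "- ?b / ?c"] by (simp add: field_simps power2_eq_square)
  qed
qed

lemma minv_inverts:
  assumes M: "M \<in> carrier_mat n n" and det: "det M \<noteq> 0"
  shows "minv M \<in> carrier_mat n n" "M * minv M = 1\<^sub>m n" "minv M * M = 1\<^sub>m n"
proof -
  have "M \<in> Units (ring_mat TYPE(real) n b)" for b
    using det_non_zero_imp_unit[OF M det] .
  then obtain P where "mat_inverse M = Some P"
    using mat_inverse(1)[OF M] by fast
  with mat_inverse(2)[OF M this]
  show "minv M \<in> carrier_mat n n" "M * minv M = 1\<^sub>m n" "minv M * M = 1\<^sub>m n"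
    by (auto simp: minv_def)
qed

text \<open>With w = M^{-1} v, Cauchy-Schwarz for the form of M gives (v.v)^2 = (v.Mw)^2 \<le>
  (v.Mv)(v.M^{-1}v), and the last factor is at most C (v.v). An upper bound on the inverse thus
  becomes a lower bound on M without diagonalization.\<close>

lemma psd_invertible_pos_def:
  assumes M: "M \<in> carrier_mat n n" "sym_psd M" and det: "det M \<noteq> 0"
  shows "\<exists>c>0. \<forall>v\<in>carrier_vec n. c * (v \<bullet> v) \<le> v \<bullet> (M *\<^sub>v v)"
proof -
  define P where "P = minv M"
  have P: "P \<in> carrier_mat n n" "M * P = 1\<^sub>m n"
    using minv_inverts[OF M(1) det] by (auto simp: P_def)
  obtain C where C: "C > 0" "\<And>v. v \<in> carrier_vec n \<Longrightarrow> v \<bullet> (P *\<^sub>v v) \<le> C * (v \<bullet> v)"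
    using quad_form_bound[OF P(1)] by blast
  have "1 / C * (v \<bullet> v) \<le> v \<bullet> (M *\<^sub>v v)" if v: "v \<in> carrier_vec n" for v
  proof (cases "v \<bullet> v = 0")
    case True
    then show ?thesis
      using M v by (simp add: sym_psd_def)
  next
    case False
    define w where "w = P *\<^sub>v v"
    have w: "w \<in> carrier_vec n"
      using P v by (auto simp: w_def)
    have Mw: "M *\<^sub>v w = v"
      using M P v by (simp add: w_def flip: assoc_mult_mat_vec)
    have Mv: "0 \<le> v \<bullet> (M *\<^sub>v v)"
      using M v by (simp add: sym_psd_def)
    have "(v \<bullet> v)\<^sup>2 \<le> (v \<bullet> (M *\<^sub>v v)) * (w \<bullet> v)"
      using psd_Cauchy_Schwarz[OF M v w] by (simp add: Mw)
    also have "w \<bullet> v = v \<bullet> (P *\<^sub>v v)"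
      using comm_scalar_prod[OF w v] by (simp add: w_def)
    also have "(v \<bullet> (M *\<^sub>v v)) * (v \<bullet> (P *\<^sub>v v)) \<le> (v \<bullet> (M *\<^sub>v v)) * (C * (v \<bullet> v))"
      using C(2)[OF v] Mv by (rule mult_left_mono)
    finally have "(v \<bullet> v) * (v \<bullet> v) \<le> (v \<bullet> (M *\<^sub>v v) * C) * (v \<bullet> v)"
      by (simp add: power2_eq_square algebra_simps)
    moreover have "0 < v \<bullet> v"
      using False scalar_prod_self_nonneg[of v] by simp
    ultimately have "v \<bullet> v \<le> v \<bullet> (M *\<^sub>v v) * C"
      by simp
    with C(1) show ?thesis
      by (simp add: field_simps)
  qed
  with C(1) show ?thesis
    by (intro exI[of _ "1 / C"]) auto
qed

section \<open>Rayleigh quotients and the ends of the spectrum\<close>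

lemma eigenvalue_Rayleigh:
  assumes "M \<in> carrier_mat n n" "e \<in> spectrum M"
  obtains v where "v \<in> carrier_vec n" "v \<bullet> v = 1" "M *\<^sub>v v = e \<cdot>\<^sub>v v" "v \<bullet> (M *\<^sub>v v) = (e :: real)"
proof -
  obtain u where u: "u \<in> carrier_vec n" "u \<noteq> 0\<^sub>v n" "M *\<^sub>v u = e \<cdot>\<^sub>v u"
    using assms by (auto simp: spectrum_def eigenvalue_def eigenvector_def)
  define v where "v = (1 / vnorm u) \<cdot>\<^sub>v u"
  have "0 < u \<bullet> u"
    using u scalar_prod_self_pos by blast
  then have "v \<bullet> v = 1"
    using u vnorm_power2[of u] by (simp add: v_def power2_eq_square vnorm_def)
  moreover have "M *\<^sub>v v = e \<cdot>\<^sub>v v"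
    using u assms by (simp add: v_def mult_mat_vec smult_smult_assoc mult.commute)
  moreover have "v \<in> carrier_vec n"
    using u by (simp add: v_def)
  ultimately show thesis
    using that[of v] by simp
qed

text \<open>If the infimum \<open>q\<close> of the Rayleigh quotient were not an eigenvalue, the positive semidefinite
\<open>M - q I\<close> would be invertible, hence bounded away from \<open>0\<close>, and \<open>q\<close> could be increased.\<close>

lemma min_Rayleigh_in_spectrum:
  fixes M :: "real mat"
  assumes M: "M \<in> carrier_mat n n" "transpose_mat M = M" and n: "0 < n"
  obtains q where "q \<in> spectrum M" "\<And>v. v \<in> carrier_vec n \<Longrightarrow> q * (v \<bullet> v) \<le> v \<bullet> (M *\<^sub>v v)"
proof -
  define S where "S = {q. \<forall>v\<in>carrier_vec n. q * (v \<bullet> v) \<le> v \<bullet> (M *\<^sub>v v)}"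
  define q where "q = Sup S"
  obtain C where C: "\<And>v. v \<in> carrier_vec n \<Longrightarrow> v \<bullet> (- M *\<^sub>v v) \<le> C * (v \<bullet> v)"
    using quad_form_bound[of "- M" n] M by auto
  have "- C \<in> S"
    using C M by (fastforce simp: S_def)
  moreover have "bdd_above S"
  proof (rule bdd_aboveI)
    fix r assume "r \<in> S"
    then have "r * (unit_vec n 0 \<bullet> unit_vec n 0) \<le> unit_vec n 0 \<bullet> (M *\<^sub>v unit_vec n 0)"
      unfolding S_def using unit_vec_carrier by blast
    then show "r \<le> unit_vec n 0 \<bullet> (M *\<^sub>v unit_vec n 0)"
      using n by simp
  qed
  ultimately have S: "S \<noteq> {}" "bdd_above S" by auto
  have le: "q * (v \<bullet> v) \<le> v \<bullet> (M *\<^sub>v v)" if v: "v \<in> carrier_vec n" for v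
  proof (cases "v \<bullet> v = 0")
    case True
    then show ?thesis
      using \<open>- C \<in> S\<close> v by (auto simp: S_def)
  next
    case False
    then have pos: "0 < v \<bullet> v"
      using scalar_prod_self_nonneg[of v] by simp
    have "q \<le> v \<bullet> (M *\<^sub>v v) / (v \<bullet> v)"
      unfolding q_def by (rule cSup_least[OF S(1)]) (use pos v in \<open>auto simp: S_def field_simps\<close>)
    with pos show ?thesis by (simp add: field_simps)
  qed
  define N where "N = char_matrix M q"
  have N: "N \<in> carrier_mat n n"
    using M by (simp add: N_def)
  have Nv: "N *\<^sub>v v = M *\<^sub>v v - q \<cdot>\<^sub>v v" if "v \<in> carrier_vec n" for v
  proof -
    have "N *\<^sub>v v = M *\<^sub>v v + (- q) \<cdot>\<^sub>v v"
      using M that unfolding N_def char_matrix_def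
      by (intro eq_vecI) (auto simp: add_scalar_prod_distrib[of _ n])
    then show ?thesis
      using M that by auto
  qed
  have quad: "v \<bullet> (N *\<^sub>v v) = v \<bullet> (M *\<^sub>v v) - q * (v \<bullet> v)" if "v \<in> carrier_vec n" for v
    using M that by (simp add: Nv scalar_prod_minus_distrib[of _ n])
  have "M $$ (i, j) = M $$ (j, i)" if "i < n" "j < n" for i j
    using M that by (metis carrier_matD index_transpose_mat(1))
  then have "transpose_mat N = N"
    using M unfolding N_def char_matrix_def by (intro eq_matI) auto
  with N le quad have "sym_psd N"
    by (auto simp: sym_psd_def)
  have "det N = 0"
  proof (rule ccontr)
    assume "det N \<noteq> 0"
    then obtain c where c: "c > 0" "\<And>v. v \<in> carrier_vec n \<Longrightarrow> c * (v \<bullet> v) \<le> v \<bullet> (N *\<^sub>v v)"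
      using psd_invertible_pos_def[OF N \<open>sym_psd N\<close>] by blast
    then have "q + c \<in> S"
      using quad by (fastforce simp: S_def algebra_simps)
    then have "q + c \<le> q"
      unfolding q_def using S(2) by (rule cSup_upper)
    with c(1) show False by simp
  qed
  then have "q \<in> spectrum M"
    using eigenvalue_det[OF M(1)] by (simp add: spectrum_def N_def)
  with le show thesis
    using that by blast
qed

lemma lambda_min_Rayleigh:
  assumes M: "M \<in> carrier_mat n n" "transpose_mat M = M" and n: "0 < n" and v: "v \<in> carrier_vec n"
  shows "lambda_min M * (v \<bullet> v) \<le> v \<bullet> (M *\<^sub>v v)"
proof -
  obtain q where q: "q \<in> spectrum M" "q * (v \<bullet> v) \<le> v \<bullet> (M *\<^sub>v v)"
    using min_Rayleigh_in_spectrum[OF M n] v by metis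
  have "lambda_min M \<le> q"
    unfolding lambda_min_def using card_finite_spectrum(1)[OF M(1)] q(1) by (rule Min_le)
  then show ?thesis
    using q(2) scalar_prod_self_nonneg[of v] by (meson mult_right_mono order_trans)
qed

text \<open>\<open>Min\<close> is informative only on a nonempty set, and a real matrix may have no
  real eigenvalue; symmetry supplies one. The minimum is then attained at a unit eigenvector, where
  the assumed bound applies.\<close>

lemma lambda_min_greatest:
  assumes M: "M \<in> carrier_mat n n" "transpose_mat M = M" and n: "0 < n"
    and le: "\<And>v. v \<in> carrier_vec n \<Longrightarrow> c * (v \<bullet> v) \<le> v \<bullet> (M *\<^sub>v v)"
  shows "c \<le> lambda_min M"
proof -
  have "spectrum M \<noteq> {}"
    using min_Rayleigh_in_spectrum[OF M n] by blast
  then have "lambda_min M \<in> spectrum M"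
    unfolding lambda_min_def using card_finite_spectrum(1)[OF M(1)] by (intro Min_in) auto
  then show ?thesis
    using le by (elim eigenvalue_Rayleigh[OF M(1)]) force
qed

lemma lambda_max_least:
  assumes M: "M \<in> carrier_mat n n" "transpose_mat M = M" and n: "0 < n"
    and le: "\<And>v. v \<in> carrier_vec n \<Longrightarrow> v \<bullet> (M *\<^sub>v v) \<le> c * (v \<bullet> v)"
  shows "lambda_max M \<le> c"
proof -
  have "spectrum M \<noteq> {}"
    using min_Rayleigh_in_spectrum[OF M n] by blast
  then have "lambda_max M \<in> spectrum M"
    unfolding lambda_max_def using card_finite_spectrum(1)[OF M(1)] by (intro Max_in) auto
  then show ?thesis
    using le by (elim eigenvalue_Rayleigh[OF M(1)]) force
qed

lemma kappa_le:
  assumes M: "M \<in> carrier_mat n n" "transpose_mat M = M" and n: "0 < n" and "0 < a" "0 \<le> b"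
    and "\<And>v. v \<in> carrier_vec n \<Longrightarrow> a * (v \<bullet> v) \<le> v \<bullet> (M *\<^sub>v v)"
    and "\<And>v. v \<in> carrier_vec n \<Longrightarrow> v \<bullet> (M *\<^sub>v v) \<le> b * (v \<bullet> v)"
  shows "kappa M \<le> b / a"
  unfolding kappa_def using lambda_min_greatest[OF M n] lambda_max_least[OF M n] assms
  by (intro frac_le) auto

text \<open>Negating M exchanges the two ends of the spectrum.\<close>

lemma max_Rayleigh_in_spectrum:
  fixes M :: "real mat"
  assumes M: "M \<in> carrier_mat n n" "transpose_mat M = M" and n: "0 < n"
  obtains q where "q \<in> spectrum M" "\<And>v. v \<in> carrier_vec n \<Longrightarrow> v \<bullet> (M *\<^sub>v v) \<le> q * (v \<bullet> v)"
proof -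
  have "- M \<in> carrier_mat n n" "transpose_mat (- M) = - M"
    using M by (auto simp: transpose_uminus)
  then obtain q where q: "q \<in> spectrum (- M)"
    and le: "\<And>v. v \<in> carrier_vec n \<Longrightarrow> q * (v \<bullet> v) \<le> v \<bullet> (- M *\<^sub>v v)"
    using min_Rayleigh_in_spectrum[OF _ _ n, of "- M"] by blast
  obtain v where v: "v \<in> carrier_vec n" "v \<bullet> v = 1" "- M *\<^sub>v v = q \<cdot>\<^sub>v v"
    using eigenvalue_Rayleigh[OF _ q] M by (metis uminus_carrier_iff_mat)
  have "M *\<^sub>v v = (- q) \<cdot>\<^sub>v v"
  proof (rule eq_vecI)
    fix i assume i: "i < dim_vec ((- q) \<cdot>\<^sub>v v)"
    have neg: "- (M *\<^sub>v v) = q \<cdot>\<^sub>v v"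
      using v M by simp
    have "i < dim_vec (M *\<^sub>v v)"
      using i v M by simp
    then have "(M *\<^sub>v v) $ i = - ((- (M *\<^sub>v v)) $ i)"
      by (simp del: index_mult_mat_vec)
    also have "\<dots> = ((- q) \<cdot>\<^sub>v v) $ i"
      using i by (simp only: neg) simp
    finally show "(M *\<^sub>v v) $ i = ((- q) \<cdot>\<^sub>v v) $ i" .
  qed (use M v in auto)
  with v M have "- q \<in> spectrum M"
    unfolding spectrum_def eigenvalue_def eigenvector_def by auto
  moreover have "w \<bullet> (M *\<^sub>v w) \<le> - q * (w \<bullet> w)" if "w \<in> carrier_vec n" for w
    using le[OF that] M that by simp
  ultimately show thesis
    by (rule that)
qed

lemma mat_eq_vecI:
  fixes A :: "real mat"
  assumes A: "A \<in> carrier_mat n m" and B: "B \<in> carrier_mat n m"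
    and eq: "\<And>v. v \<in> carrier_vec m \<Longrightarrow> A *\<^sub>v v = B *\<^sub>v v"
  shows "A = B"
proof (rule eq_matI)
  fix i j assume ij: "i < dim_row B" "j < dim_col B"
  have "(A *\<^sub>v unit_vec m j) $ i = (B *\<^sub>v unit_vec m j) $ i"
    using eq[of "unit_vec m j"] by simp
  then show "A $$ (i, j) = B $$ (i, j)"
    using A B ij by simp
qed (use A B in auto)

text \<open>Cauchy-Schwarz for the form of M, applied to Mv and v, bounds |Mv|^4 by a multiple of
  v.Mv, which vanishes.\<close>

lemma psd_eq_zero:
  assumes M: "M \<in> carrier_mat n n" "sym_psd M"
    and z: "\<And>v. v \<in> carrier_vec n \<Longrightarrow> v \<bullet> (M *\<^sub>v v) \<le> 0"
  shows "M = 0\<^sub>m n n"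
proof (rule mat_eq_vecI[OF M(1)])
  fix v :: "real vec" assume v: "v \<in> carrier_vec n"
  have Mv: "M *\<^sub>v v \<in> carrier_vec n"
    using M v by auto
  have "v \<bullet> (M *\<^sub>v v) = 0"
    using z[OF v] M v by (auto simp: sym_psd_def intro: antisym)
  then have "(M *\<^sub>v v) \<bullet> (M *\<^sub>v v) = 0"
    using psd_Cauchy_Schwarz[OF M Mv v] by simp
  then have "M *\<^sub>v v = 0\<^sub>v n"
    using scalar_prod_self_pos[OF Mv] by fastforce
  then show "M *\<^sub>v v = 0\<^sub>m n n *\<^sub>v v"
    using v by (intro eq_vecI) (auto simp: scalar_prod_def)
qed simp

section \<open>Square roots of positive semidefinite matrices\<close>

lemma sym_mat_scalar_prod:
  fixes M :: "real mat"
  assumes "M \<in> carrier_mat n n" "transpose_mat M = M" "u \<in> carrier_vec n" "v \<in> carrier_vec n"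
  shows "u \<bullet> (M *\<^sub>v v) = (M *\<^sub>v u) \<bullet> v"
  using transpose_vec_mult_scalar[OF assms(1,4,3)] assms(2) by simp

text \<open>The matrix M + c v v^T. With c = -e it removes a unit eigenvector v of eigenvalue e from
  a symmetric M; with c = sqrt e it puts v back into a square root.\<close>

definition rank_one_update :: "real mat \<Rightarrow> real \<Rightarrow> real vec \<Rightarrow> real mat" where
  "rank_one_update M c v = mat (dim_row M) (dim_row M) (\<lambda>(i, j). M $$ (i, j) + c * v $ i * v $ j)"

context
  fixes M :: "real mat" and v :: "real vec" and n :: nat
  assumes M: "M \<in> carrier_mat n n" and v: "v \<in> carrier_vec n"
begin

lemma rank_one_update_carrier: "rank_one_update M c v \<in> carrier_mat n n"
  using M by (simp add: rank_one_update_def)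

lemma rank_one_update_mult_vec:
  assumes w: "w \<in> carrier_vec n"
  shows "rank_one_update M c v *\<^sub>v w = M *\<^sub>v w + (c * (v \<bullet> w)) \<cdot>\<^sub>v v"
  using M v w
  by (intro eq_vecI) (auto simp: rank_one_update_def scalar_prod_def sum.distrib sum_distrib_left
      sum_distrib_right algebra_simps intro!: sum.cong)

lemma rank_one_update_quad_form:
  assumes w: "w \<in> carrier_vec n"
  shows "w \<bullet> (rank_one_update M c v *\<^sub>v w) = w \<bullet> (M *\<^sub>v w) + c * (v \<bullet> w)\<^sup>2"
proof -
  have "w \<bullet> v = v \<bullet> w"
    using v w by (rule comm_scalar_prod[rotated])
  then show ?thesis
    using M v w
    by (simp add: rank_one_update_mult_vec scalar_prod_add_distrib[of _ n] power2_eq_square)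
qed

lemma rank_one_update_sym:
  assumes sym: "transpose_mat M = M"
  shows "transpose_mat (rank_one_update M c v) = rank_one_update M c v"
proof -
  have "M $$ (i, j) = M $$ (j, i)" if "i < n" "j < n" for i j
    using M sym that by (metis carrier_matD index_transpose_mat(1))
  then show ?thesis
    using M by (intro eq_matI) (auto simp: rank_one_update_def)
qed

lemma rank_one_update_psdI:
  assumes "transpose_mat M = M"
    and "\<And>w. w \<in> carrier_vec n \<Longrightarrow> 0 \<le> w \<bullet> (M *\<^sub>v w) + c * (v \<bullet> w)\<^sup>2"
  shows "sym_psd (rank_one_update M c v)"
  using assms rank_one_update_sym[of c] rank_one_update_carrier[of c]
  by (auto simp: sym_psd_def rank_one_update_quad_form)

lemma rank_one_update_trace:
  "(\<Sum>i<n. rank_one_update M c v $$ (i, i)) = (\<Sum>i<n. M $$ (i, i)) + c * (v \<bullet> v)"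
  using M v by (simp add: rank_one_update_def sum.distrib sum_distrib_left scalar_prod_def
      lessThan_atLeast0 mult.assoc)

end

text \<open>If the largest Rayleigh quotient were not positive, the form would be nonpositive and M
  would be 0.\<close>

lemma psd_max_eigenvector:
  assumes M: "M \<in> carrier_mat n n" "sym_psd M" and nz: "M \<noteq> 0\<^sub>m n n"
  obtains e v where "0 < e" "v \<in> carrier_vec n" "v \<bullet> v = 1" "M *\<^sub>v v = e \<cdot>\<^sub>v v"
proof -
  have sym: "transpose_mat M = M"
    using M by (simp add: sym_psd_def)
  have "0 < n"
    using nz M by (cases n) auto
  then obtain e where e: "e \<in> spectrum M" "\<And>v. v \<in> carrier_vec n \<Longrightarrow> v \<bullet> (M *\<^sub>v v) \<le> e * (v \<bullet> v)"
    using max_Rayleigh_in_spectrum[OF M(1) sym] by blast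
  have "0 < e"
  proof (rule ccontr)
    assume "\<not> 0 < e"
    then have "e * (v \<bullet> v) \<le> 0" for v :: "real vec"
      using scalar_prod_self_nonneg[of v] by (intro mult_nonpos_nonneg) auto
    then have "v \<bullet> (M *\<^sub>v v) \<le> 0" if "v \<in> carrier_vec n" for v
      using e(2)[OF that] by (meson order_trans)
    then show False
      using psd_eq_zero[OF M] nz by blast
  qed
  then show thesis
    using that eigenvalue_Rayleigh[OF M(1) e(1)] by metis
qed

text \<open>Since R R v = M v - e v = 0 and R is symmetric, R v = 0. The cross terms in the square
  of R + sqrt e v v^T therefore vanish, and what remains is R R + e v v^T = M.\<close>

lemma psd_sqrt_undeflate:
  assumes M: "M \<in> carrier_mat n n" and v: "v \<in> carrier_vec n" "v \<bullet> v = 1" "M *\<^sub>v v = e \<cdot>\<^sub>v v" and e: "0 < e"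
    and R: "R \<in> carrier_mat n n" "sym_psd R" "R * R = rank_one_update M (- e) v"
  defines "S \<equiv> rank_one_update R (sqrt e) v"
  shows "S \<in> carrier_mat n n" "sym_psd S" "S * S = M"
proof -
  have Rsym: "transpose_mat R = R"
    using R by (simp add: sym_psd_def)
  show S: "S \<in> carrier_mat n n"
    unfolding S_def using R(1) v(1) by (rule rank_one_update_carrier)
  show "sym_psd S"
    unfolding S_def using R(1) v(1) Rsym
    by (rule rank_one_update_psdI) (use R e in \<open>auto simp: sym_psd_def\<close>)
  have RRw: "R *\<^sub>v (R *\<^sub>v w) = M *\<^sub>v w + (- e * (v \<bullet> w)) \<cdot>\<^sub>v v" if w: "w \<in> carrier_vec n" for w
    using rank_one_update_mult_vec[OF M v(1) w, of "- e"] R w by (metis assoc_mult_mat_vec)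
  have Rw: "R *\<^sub>v w \<in> carrier_vec n" if "w \<in> carrier_vec n" for w
    using R that by (rule_tac mult_mat_vec_carrier)
  have "R *\<^sub>v (R *\<^sub>v v) = 0\<^sub>v n"
    using v by (subst RRw) auto
  then have "(R *\<^sub>v v) \<bullet> (R *\<^sub>v v) = 0"
    using sym_mat_scalar_prod[OF R(1) Rsym v(1) Rw[OF v(1)]] v by simp
  then have Rv: "R *\<^sub>v v = 0\<^sub>v n"
    using scalar_prod_self_pos[OF Rw[OF v(1)]] by fastforce
  have smult_zero: "k \<cdot>\<^sub>v 0\<^sub>v n = 0\<^sub>v n" for k :: real
    by (intro eq_vecI) auto
  show "S * S = M"
  proof (rule mat_eq_vecI[OF _ M])
    fix w :: "real vec" assume w: "w \<in> carrier_vec n"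
    have vRw: "v \<bullet> (R *\<^sub>v w) = 0"
      using sym_mat_scalar_prod[OF R(1) Rsym v(1) w] Rv w by simp
    have Sw: "S *\<^sub>v w = R *\<^sub>v w + (sqrt e * (v \<bullet> w)) \<cdot>\<^sub>v v"
      unfolding S_def using R(1) v(1) w by (rule rank_one_update_mult_vec)
    have "S *\<^sub>v (S *\<^sub>v w) = R *\<^sub>v (S *\<^sub>v w) + (sqrt e * (v \<bullet> (S *\<^sub>v w))) \<cdot>\<^sub>v v"
      unfolding S_def using R(1) v(1)
      by (rule rank_one_update_mult_vec) (use S w in \<open>auto simp: S_def\<close>)
    also have "R *\<^sub>v (S *\<^sub>v w) = R *\<^sub>v (R *\<^sub>v w)"
      unfolding Sw using mult_add_distrib_mat_vec[OF R(1) Rw[OF w], of "(sqrt e * (v \<bullet> w)) \<cdot>\<^sub>v v"]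
        mult_mat_vec[OF R(1) v(1)] v Rv Rw[OF Rw[OF w]] by (simp add: smult_zero)
    also have "v \<bullet> (S *\<^sub>v w) = sqrt e * (v \<bullet> w)"
      unfolding Sw using scalar_prod_add_distrib[OF v(1) Rw[OF w], of "(sqrt e * (v \<bullet> w)) \<cdot>\<^sub>v v"]
        v vRw by simp
    also have "sqrt e * (sqrt e * (v \<bullet> w)) = e * (v \<bullet> w)"
      using e by (simp flip: mult.assoc)
    finally have "S *\<^sub>v (S *\<^sub>v w) = M *\<^sub>v w + (- e * (v \<bullet> w)) \<cdot>\<^sub>v v + (e * (v \<bullet> w)) \<cdot>\<^sub>v v"
      by (simp only: RRw[OF w])
    also have "\<dots> = M *\<^sub>v w"
      using M v w by (intro eq_vecI) (auto simp del: index_mult_mat_vec)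
    finally show "(S * S) *\<^sub>v w = M *\<^sub>v w"
      using S w by simp
  qed (use S in simp)
qed

text \<open>Deflation: the eigenvectors of \<open>M\<close> with positive eigenvalue are split off one at a time. The matrix
\<open>P\<close> is the projection onto those found so far; its trace counts them, so there are at most \<open>n\<close>.\<close>

lemma psd_deflate:
  assumes M: "M \<in> carrier_mat n n" "sym_psd M"
    and P: "P \<in> carrier_mat n n" "transpose_mat P = P"
      "\<And>w. w \<in> carrier_vec n \<Longrightarrow> w \<bullet> (P *\<^sub>v w) \<le> w \<bullet> w"
    and MP: "\<And>w. w \<in> carrier_vec n \<Longrightarrow> M *\<^sub>v (P *\<^sub>v w) = 0\<^sub>v n"
    and e: "0 < e" and v: "v \<in> carrier_vec n" "v \<bullet> v = 1" "M *\<^sub>v v = e \<cdot>\<^sub>v v"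
  defines "M' \<equiv> rank_one_update M (- e) v" and "P' \<equiv> rank_one_update P 1 v"
  shows "sym_psd M'"
    and "\<And>w. w \<in> carrier_vec n \<Longrightarrow> w \<bullet> (P' *\<^sub>v w) \<le> w \<bullet> w"
    and "\<And>w. w \<in> carrier_vec n \<Longrightarrow> M' *\<^sub>v (P' *\<^sub>v w) = 0\<^sub>v n"
proof -
  have Msym: "transpose_mat M = M"
    using M by (simp add: sym_psd_def)
  have vM: "v \<bullet> (M *\<^sub>v w) = e * (v \<bullet> w)" if "w \<in> carrier_vec n" for w
    using sym_mat_scalar_prod[OF M(1) Msym v(1) that] v that by simp
  \<comment> \<open>M annihilates the range of P, and e (v.Pw) = v.M(Pw); as e is nonzero, v is
    orthogonal to that range.\<close>
  have vP: "v \<bullet> (P *\<^sub>v w) = 0" if w: "w \<in> carrier_vec n" for w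
  proof -
    have "P *\<^sub>v w \<in> carrier_vec n"
      using P w by auto
    from vM[OF this] MP[OF w] v e show ?thesis
      by simp
  qed
  show "sym_psd M'"
    unfolding M'_def
  proof (rule rank_one_update_psdI[OF M(1) v(1) Msym])
    fix w :: "real vec" assume w: "w \<in> carrier_vec n"
    \<comment> \<open>Cauchy-Schwarz for the form of M, with v.Mv = e and v.Mw = e (v.w).\<close>
    have "(e * (v \<bullet> w))\<^sup>2 \<le> e * (w \<bullet> (M *\<^sub>v w))"
      using psd_Cauchy_Schwarz[OF M v(1) w] v by (simp add: vM w)
    then have "e * (v \<bullet> w)\<^sup>2 \<le> w \<bullet> (M *\<^sub>v w)"
      using e by (simp add: power2_eq_square ac_simps)
    then show "0 \<le> w \<bullet> (M *\<^sub>v w) + - e * (v \<bullet> w)\<^sup>2"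
      by simp
  qed
  show "w \<bullet> (P' *\<^sub>v w) \<le> w \<bullet> w" if w: "w \<in> carrier_vec n" for w
  proof -
    \<comment> \<open>u is w without its component along v. P does not see that component, so the
      bound for P at u, increased by (v.w)^2 on both sides, is the bound for \<open>P'\<close> at
      w.\<close>
    define u where "u = w + (- (v \<bullet> w)) \<cdot>\<^sub>v v"
    have u: "u \<in> carrier_vec n"
      using v w by (simp add: u_def)
    have wv: "w \<bullet> v = v \<bullet> w"
      using v w by (simp add: comm_scalar_prod[of v n w])
    have "u \<bullet> (P *\<^sub>v u) = w \<bullet> (P *\<^sub>v w)"
      using quad_form_perturb[OF P(1,2) w v(1), of "- (v \<bullet> w)"] vP[OF v(1)] vP[OF w]
        sym_mat_scalar_prod[OF P(1,2) w v(1)] comm_scalar_prod[of "P *\<^sub>v w" n v] P w v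
      by (simp add: u_def)
    moreover have "u \<bullet> u = w \<bullet> w - (v \<bullet> w)\<^sup>2"
      using quad_form_perturb[of "1\<^sub>m n" n w v "- (v \<bullet> w)"] u v w
      by (simp add: u_def[symmetric] wv power2_eq_square)
    ultimately show ?thesis
      using P(3)[OF u] rank_one_update_quad_form[OF P(1) v(1) w, of 1] by (simp add: P'_def)
  qed
  show "M' *\<^sub>v (P' *\<^sub>v w) = 0\<^sub>v n" if w: "w \<in> carrier_vec n" for w
  proof -
    have Pw: "P *\<^sub>v w \<in> carrier_vec n"
      using P w by auto
    have P'w: "P' *\<^sub>v w = P *\<^sub>v w + (v \<bullet> w) \<cdot>\<^sub>v v"
      using rank_one_update_mult_vec[OF P(1) v(1) w, of 1] by (simp add: P'_def)
    then have P'w': "P' *\<^sub>v w \<in> carrier_vec n"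
      using Pw v by simp
    have "M *\<^sub>v (P' *\<^sub>v w) = (v \<bullet> w * e) \<cdot>\<^sub>v v"
      unfolding P'w using mult_add_distrib_mat_vec[OF M(1) Pw, of "(v \<bullet> w) \<cdot>\<^sub>v v"]
        mult_mat_vec[OF M(1) v(1)] v MP[OF w] by (simp add: smult_smult_assoc)
    moreover have "v \<bullet> (P' *\<^sub>v w) = v \<bullet> w"
      unfolding P'w using scalar_prod_add_distrib[OF v(1) Pw, of "(v \<bullet> w) \<cdot>\<^sub>v v"] v vP[OF w] by simp
    ultimately have "M' *\<^sub>v (P' *\<^sub>v w) = (v \<bullet> w * e) \<cdot>\<^sub>v v + (- e * (v \<bullet> w)) \<cdot>\<^sub>v v"
      using rank_one_update_mult_vec[OF M(1) v(1) P'w', of "- e"] by (simp add: M'_def)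
    also have "\<dots> = 0\<^sub>v n"
      using v by (intro eq_vecI) auto
    finally show ?thesis .
  qed
qed

text \<open>Here d is the budget of remaining deflations. Each one raises the trace of P by v.v = 1,
  which preserves the last assumption as d drops. An exhausted budget is contradictory: the diagonal
  entries of P are at most 1, so its trace cannot exceed n. The recursion can therefore end only at
  M = 0.\<close>

lemma psd_sqrt_exists_deflated:
  assumes "M \<in> carrier_mat n n" "sym_psd M"
    and "P \<in> carrier_mat n n" "transpose_mat P = P"
    and "\<And>w. w \<in> carrier_vec n \<Longrightarrow> w \<bullet> (P *\<^sub>v w) \<le> w \<bullet> w"
    and "\<And>w. w \<in> carrier_vec n \<Longrightarrow> M *\<^sub>v (P *\<^sub>v w) = 0\<^sub>v n"
    and "real n < (\<Sum>i<n. P $$ (i, i)) + real d"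
  shows "\<exists>R\<in>carrier_mat n n. sym_psd R \<and> R * R = M"
  using assms
proof (induction d arbitrary: M P)
  case (0 M P)
  have "P $$ (i, i) \<le> 1" if "i < n" for i
    using 0(5)[of "unit_vec n i"] 0(3) that by simp
  then have "(\<Sum>i<n. P $$ (i, i)) \<le> (\<Sum>i<n. 1)"
    by (intro sum_mono) auto
  with 0(7) show ?case by simp
next
  case (Suc d M P)
  note M = Suc.prems(1,2) and P = Suc.prems(3-5) and MP = Suc.prems(6)
  show ?case
  proof (cases "M = 0\<^sub>m n n")
    case True
    have "sym_psd (0\<^sub>m n n)"
      by (auto simp: sym_psd_def scalar_prod_def)
    then show ?thesis
      using True by (intro bexI[of _ "0\<^sub>m n n"]) auto
  next
    case False
    then obtain e v where e: "0 < e" and v: "v \<in> carrier_vec n" "v \<bullet> v = 1" "M *\<^sub>v v = e \<cdot>\<^sub>v v"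
      using psd_max_eigenvector[OF M] by blast
    note defl = psd_deflate[OF M P MP e v]
    obtain R where "R \<in> carrier_mat n n" "sym_psd R" "R * R = rank_one_update M (- e) v"
      using Suc.IH[OF rank_one_update_carrier[OF M(1) v(1)] defl(1)
          rank_one_update_carrier[OF P(1) v(1)] rank_one_update_sym[OF P(1) v(1) P(2)] defl(2,3)]
        rank_one_update_trace[OF P(1) v(1), of 1] v(2) Suc.prems(7) by auto
    then show ?thesis
      using psd_sqrt_undeflate[OF M(1) v e] by blast
  qed
qed

lemma psd_sqrt_exists:
  assumes M: "M \<in> carrier_mat n n" "sym_psd M"
  obtains R where "R \<in> carrier_mat n n" "sym_psd R" "R * R = M"
proof -
  have z: "0\<^sub>m n n *\<^sub>v w = 0\<^sub>v n" if "w \<in> carrier_vec n" for w :: "real vec"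
    using that by (intro eq_vecI) (auto simp: scalar_prod_def)
  have "M *\<^sub>v 0\<^sub>v n = 0\<^sub>v n"
    using M by (intro eq_vecI) auto
  \<comment> \<open>Starting from P = 0 with trace 0, the strict inequality demands a budget of n +
    1.\<close>
  then show thesis
    using psd_sqrt_exists_deflated[OF M, of "0\<^sub>m n n" "Suc n"] that
    by (auto simp: z scalar_prod_self_nonneg)
qed

text \<open>For a unit eigenvector v of D = R - S with eigenvalue d, adding the products of Dv = d v
  with Rv and Sv gives d (v.Rv + v.Sv) = |Rv|^2 - |Sv|^2 = 0. Since R is positive definite, d = 0. A
  symmetric matrix whose only eigenvalue is 0 is the zero matrix.\<close>

lemma psd_sqrt_unique:
  assumes R: "R \<in> carrier_mat n n" "sym_psd R" and S: "S \<in> carrier_mat n n" "sym_psd S"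
    and eq: "R * R = S * S" and det: "det R \<noteq> 0" and n: "0 < n"
  shows "R = S"
proof -
  define D where "D = R - S"
  have D: "D \<in> carrier_mat n n"
    unfolding D_def using S(1) by (rule minus_carrier_mat)
  have sym: "transpose_mat R = R" "transpose_mat S = S"
    using R S by (auto simp: sym_psd_def)
  then have Dsym: "transpose_mat D = D"
    using R S by (simp add: D_def transpose_minus)
  have Dw: "D *\<^sub>v w = R *\<^sub>v w - S *\<^sub>v w" if "w \<in> carrier_vec n" for w
    using R S that by (simp add: D_def minus_mult_distrib_mat_vec)
  obtain c where c: "0 < c" "\<And>v. v \<in> carrier_vec n \<Longrightarrow> c * (v \<bullet> v) \<le> v \<bullet> (R *\<^sub>v v)"
    using psd_invertible_pos_def[OF R det] by blast
  have ev0: "d = 0" if d: "d \<in> spectrum D" for d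
  proof -
    obtain v where v: "v \<in> carrier_vec n" "v \<bullet> v = 1" "D *\<^sub>v v = d \<cdot>\<^sub>v v"
      using eigenvalue_Rayleigh[OF D d] by metis
    have Rv: "R *\<^sub>v v \<in> carrier_vec n" and Sv: "S *\<^sub>v v \<in> carrier_vec n"
      using R S v by auto
    have "R *\<^sub>v (R *\<^sub>v v) = S *\<^sub>v (S *\<^sub>v v)"
      using eq R(1) S(1) v(1) by (metis assoc_mult_mat_vec)
    then have "(R *\<^sub>v v) \<bullet> (R *\<^sub>v v) = (S *\<^sub>v v) \<bullet> (S *\<^sub>v v)"
      using sym_mat_scalar_prod[OF R(1) sym(1) v(1) Rv] sym_mat_scalar_prod[OF S(1) sym(2) v(1) Sv]
      by simp
    moreover have "d * (v \<bullet> (R *\<^sub>v v)) = (R *\<^sub>v v) \<bullet> (R *\<^sub>v v) - (S *\<^sub>v v) \<bullet> (R *\<^sub>v v)"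
      using minus_scalar_prod_distrib[OF Rv Sv Rv] v Rv by (simp flip: Dw[OF v(1)])
    moreover have "d * (v \<bullet> (S *\<^sub>v v)) = (R *\<^sub>v v) \<bullet> (S *\<^sub>v v) - (S *\<^sub>v v) \<bullet> (S *\<^sub>v v)"
      using minus_scalar_prod_distrib[OF Rv Sv Sv] v Sv by (simp flip: Dw[OF v(1)])
    moreover have "(R *\<^sub>v v) \<bullet> (S *\<^sub>v v) = (S *\<^sub>v v) \<bullet> (R *\<^sub>v v)"
      using Rv Sv by (rule comm_scalar_prod)
    ultimately have "d * (v \<bullet> (R *\<^sub>v v) + v \<bullet> (S *\<^sub>v v)) = 0"
      by (simp add: algebra_simps)
    moreover have "0 < v \<bullet> (R *\<^sub>v v)" "0 \<le> v \<bullet> (S *\<^sub>v v)"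
      using c(1) c(2)[OF v(1)] v S by (auto simp: sym_psd_def)
    ultimately show ?thesis by simp
  qed
  have "0 \<le> v \<bullet> (D *\<^sub>v v)" if "v \<in> carrier_vec n" for v
    using min_Rayleigh_in_spectrum[OF D Dsym n] ev0 that by (metis mult_zero_left)
  moreover have "v \<bullet> (D *\<^sub>v v) \<le> 0" if "v \<in> carrier_vec n" for v
    using max_Rayleigh_in_spectrum[OF D Dsym n] ev0 that by (metis mult_zero_left)
  ultimately have "D = 0\<^sub>m n n"
    using D Dsym by (intro psd_eq_zero) (auto simp: sym_psd_def)
  then have "R $$ (i, j) = S $$ (i, j)" if "i < n" "j < n" for i j
    using R S that by (metis D_def carrier_matD eq_iff_diff_eq_0 index_minus_mat(1) index_zero_mat(1))
  then show "R = S"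
    using R S by (intro eq_matI) auto
qed

lemma inv_sqrt_inverts_sqrt:
  assumes M: "M \<in> carrier_mat n n" "sym_psd M" and det: "det M \<noteq> 0" and n: "0 < n"
  obtains R where "R \<in> carrier_mat n n" "transpose_mat R = R" "R * R = M"
    "inv_sqrt M \<in> carrier_mat n n" "R * inv_sqrt M = 1\<^sub>m n" "inv_sqrt M * R = 1\<^sub>m n"
proof -
  obtain R where R: "R \<in> carrier_mat n n" "sym_psd R" "R * R = M"
    using psd_sqrt_exists[OF M] .
  have detR: "det R \<noteq> 0"
    using det det_mult[OF R(1) R(1)] R(3) by auto
  have "mat_sqrt M = R"
    unfolding mat_sqrt_def
  proof (rule the_equality)
    fix S assume S: "sym_psd S \<and> S * S = M"
    \<comment> \<open>The description in \<open>mat_sqrt\<close> fixes no dimensions; those of S are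
      read off from S * S = M.\<close>
    then have "dim_row S = n" "dim_col S = n"
      using M(1) by (metis carrier_matD index_mult_mat(2,3))+
    then have "S \<in> carrier_mat n n"
      by blast
    with S show "S = R"
      using psd_sqrt_unique[OF R(1,2) _ _ _ detR n] R(3) by metis
  qed (use R in simp)
  then show thesis
    using that[OF R(1) _ R(3)] minv_inverts[OF R(1) detR] R by (simp add: inv_sqrt_def sym_psd_def)
qed

text \<open>Substituting P v for v, where P = \<open>inv_sqrt M\<close>, turns v.v into the form of
  M and the form of P N P into that of N. The Rayleigh quotients of the conjugated matrix are thus
  the ratios of the two forms.\<close>

lemma kappa_inv_sqrt_conjugate_le:
  assumes M: "M \<in> carrier_mat n n" "sym_psd M" and det: "det M \<noteq> 0" and n: "0 < n"
    and N: "N \<in> carrier_mat n n" "transpose_mat N = N"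
    and a: "0 < a" "\<And>v. v \<in> carrier_vec n \<Longrightarrow> a * (v \<bullet> (M *\<^sub>v v)) \<le> v \<bullet> (N *\<^sub>v v)"
    and b: "0 \<le> b" "\<And>v. v \<in> carrier_vec n \<Longrightarrow> v \<bullet> (N *\<^sub>v v) \<le> b * (v \<bullet> (M *\<^sub>v v))"
  shows "kappa (inv_sqrt M * N * inv_sqrt M) \<le> b / a"
proof -
  define P where "P = inv_sqrt M"
  obtain R where R: "R \<in> carrier_mat n n" "transpose_mat R = R" "R * R = M"
    and P: "P \<in> carrier_mat n n" "R * P = 1\<^sub>m n" "P * R = 1\<^sub>m n"
    using inv_sqrt_inverts_sqrt[OF M det n] P_def by metis
  \<comment> \<open>P^T is a left inverse of R as well, so associativity forces it to equal the
    right inverse P.\<close>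
  have "transpose_mat P * R = 1\<^sub>m n"
    using transpose_mult[OF R(1) P(1)] R P by simp
  then have Psym: "transpose_mat P = P"
    using assoc_mult_mat[of "transpose_mat P" n n R n P n] R P by simp
  define W where "W = P * N * P"
  have W: "W \<in> carrier_mat n n"
    using P N by (simp add: W_def)
  have "transpose_mat W = W"
    using P N transpose_mult[of "P * N" n n P n] transpose_mult[of P n n N n]
    by (simp add: W_def Psym)
  moreover have "v \<bullet> (W *\<^sub>v v) = (P *\<^sub>v v) \<bullet> (N *\<^sub>v (P *\<^sub>v v))"
    and "v \<bullet> v = (P *\<^sub>v v) \<bullet> (M *\<^sub>v (P *\<^sub>v v))" if v: "v \<in> carrier_vec n" for v
  proof -
    have Pv: "P *\<^sub>v v \<in> carrier_vec n" and NPv: "N *\<^sub>v (P *\<^sub>v v) \<in> carrier_vec n"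
      using P N v by auto
    have "W *\<^sub>v v = P *\<^sub>v (N *\<^sub>v (P *\<^sub>v v))"
      using assoc_mult_mat_vec[of "P * N" n n P n v] assoc_mult_mat_vec[of P n n N n "P *\<^sub>v v"] P N v Pv
      unfolding W_def by simp
    then show "v \<bullet> (W *\<^sub>v v) = (P *\<^sub>v v) \<bullet> (N *\<^sub>v (P *\<^sub>v v))"
      using sym_mat_scalar_prod[OF P(1) Psym v NPv] by simp
    have RPv: "R *\<^sub>v (P *\<^sub>v v) = v"
      using R P v by (simp flip: assoc_mult_mat_vec)
    then have "M *\<^sub>v (P *\<^sub>v v) = R *\<^sub>v v"
      using R(1,3) Pv by (metis assoc_mult_mat_vec)
    then show "v \<bullet> v = (P *\<^sub>v v) \<bullet> (M *\<^sub>v (P *\<^sub>v v))"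
      using sym_mat_scalar_prod[OF R(1,2) Pv v] RPv by simp
  qed
  moreover have "P *\<^sub>v v \<in> carrier_vec n" if "v \<in> carrier_vec n" for v
    using P that by auto
  ultimately have "kappa W \<le> b / a"
    using a b by (intro kappa_le[OF W _ n]) auto
  then show ?thesis
    by (simp add: W_def P_def)
qed

section \<open>Operator norms, column submatrices and normal matrices\<close>

lemma Gram_mat_props:
  fixes A :: "real mat"
  assumes A: "A \<in> carrier_mat m n"
  shows "transpose_mat A * A \<in> carrier_mat n n"
    and "transpose_mat (transpose_mat A * A) = transpose_mat A * A"
    and "v \<in> carrier_vec n \<Longrightarrow> v \<bullet> (transpose_mat A * A *\<^sub>v v) = (vnorm (A *\<^sub>v v))\<^sup>2"
proof -
  show "transpose_mat A * A \<in> carrier_mat n n"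
    using A by simp
  show "transpose_mat (transpose_mat A * A) = transpose_mat A * A"
    using A transpose_mult[of "transpose_mat A" n m A n] by simp
  show "v \<bullet> (transpose_mat A * A *\<^sub>v v) = (vnorm (A *\<^sub>v v))\<^sup>2" if v: "v \<in> carrier_vec n"
  proof -
    have Av: "A *\<^sub>v v \<in> carrier_vec m"
      using A v by auto
    have "transpose_mat A * A *\<^sub>v v = transpose_mat A *\<^sub>v (A *\<^sub>v v)"
      using A v by (intro assoc_mult_mat_vec) auto
    moreover have "v \<bullet> (transpose_mat A *\<^sub>v (A *\<^sub>v v)) = (transpose_mat A *\<^sub>v (A *\<^sub>v v)) \<bullet> v"
      using A v Av by (intro comm_scalar_prod) auto
    ultimately show ?thesis
      using transpose_vec_mult_scalar[OF A v Av] by (simp add: vnorm_power2)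
  qed
qed

lemma mult_mat_zero_vec:
  fixes A :: "real mat"
  assumes "A \<in> carrier_mat m n"
  shows "A *\<^sub>v 0\<^sub>v n = 0\<^sub>v m"
  using assms by (intro eq_vecI) auto

lemma vnorm_zero_iff:
  assumes "v \<in> carrier_vec n"
  shows "vnorm v = 0 \<longleftrightarrow> v = 0\<^sub>v n"
  using scalar_prod_self_pos[OF assms] assms by (cases "v = 0\<^sub>v n") (auto simp: vnorm_def)

text \<open>Without a bound the real supremum in \<open>op_norm\<close> would carry no information;
  the quadratic form of A^T A supplies one.\<close>

lemma op_norm_bdd_above:
  assumes A: "A \<in> carrier_mat m n"
  shows "bdd_above ((\<lambda>v. vnorm (A *\<^sub>v v)) ` {v \<in> carrier_vec (dim_col A). vnorm v \<le> 1})"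
proof -
  obtain C where C: "C > 0" "\<And>v. v \<in> carrier_vec n \<Longrightarrow> v \<bullet> (transpose_mat A * A *\<^sub>v v) \<le> C * (v \<bullet> v)"
    using quad_form_bound[OF Gram_mat_props(1)[OF A]] by blast
  have "vnorm (A *\<^sub>v v) \<le> sqrt C" if "v \<in> carrier_vec n" "vnorm v \<le> 1" for v
  proof (rule real_le_rsqrt)
    have "v \<bullet> v \<le> 1"
      using that(2) vnorm_nonneg[of v] power_le_one[of "vnorm v" 2] by (simp add: vnorm_power2)
    then have "C * (v \<bullet> v) \<le> C"
      using C(1) by simp
    then show "(vnorm (A *\<^sub>v v))\<^sup>2 \<le> C"
      using C(2)[OF that(1)] Gram_mat_props(3)[OF A that(1)] by simp
  qed
  then show ?thesis
    using A by (intro bdd_aboveI[of _ "sqrt C"]) auto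
qed

lemma op_norm_nonneg:
  assumes A: "A \<in> carrier_mat m n"
  shows "0 \<le> op_norm A"
proof -
  have "vnorm (A *\<^sub>v 0\<^sub>v n) \<le> op_norm A"
    unfolding op_norm_def
    by (rule cSUP_upper[OF _ op_norm_bdd_above[OF A]]) (use A vnorm_zero_iff[of "0\<^sub>v n" n] in auto)
  then show ?thesis
    using vnorm_nonneg order_trans by blast
qed

lemma vnorm_mult_mat_le:
  assumes A: "A \<in> carrier_mat m n" and v: "v \<in> carrier_vec n"
  shows "vnorm (A *\<^sub>v v) \<le> op_norm A * vnorm v"
proof (cases "v = 0\<^sub>v n")
  case True
  then have "A *\<^sub>v v = 0\<^sub>v m" "vnorm v = 0"
    using mult_mat_zero_vec[OF A] vnorm_zero_iff[OF v] by auto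
  then show ?thesis
    using vnorm_zero_iff[of "0\<^sub>v m" m] by simp
next
  case False
  then have pos: "0 < vnorm v"
    using vnorm_zero_iff[OF v] vnorm_nonneg[of v] by simp
  define u where "u = (1 / vnorm v) \<cdot>\<^sub>v v"
  have "vnorm (A *\<^sub>v u) \<le> op_norm A"
    unfolding op_norm_def
    by (rule cSUP_upper[OF _ op_norm_bdd_above[OF A]]) (use A v pos in \<open>auto simp: u_def vnorm_smult\<close>)
  moreover have "vnorm (A *\<^sub>v u) = vnorm (A *\<^sub>v v) / vnorm v"
    using pos by (simp add: u_def mult_mat_vec[OF A v] vnorm_smult)
  ultimately show ?thesis
    using pos by (simp add: field_simps)
qed

text \<open>|A^T v|^2 = v.A(A^T v); Cauchy-Schwarz and the bound for A apply, and one factor |A^T v|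
  cancels.\<close>

lemma vnorm_transpose_mult_le:
  assumes A: "A \<in> carrier_mat m n" and v: "v \<in> carrier_vec m"
  shows "vnorm (transpose_mat A *\<^sub>v v) \<le> op_norm A * vnorm v"
proof -
  define w where "w = transpose_mat A *\<^sub>v v"
  have w: "w \<in> carrier_vec n" "A *\<^sub>v w \<in> carrier_vec m"
    using A v by (auto simp: w_def)
  have "vnorm w * vnorm w = v \<bullet> (A *\<^sub>v w)"
    using transpose_vec_mult_scalar[OF A w(1) v] vnorm_power2[of w]
    by (simp add: w_def power2_eq_square)
  also have "\<dots> \<le> vnorm v * (op_norm A * vnorm w)"
    using scalar_prod_le_vnorm[OF v w(2)] mult_left_mono[OF vnorm_mult_mat_le[OF A w(1)] vnorm_nonneg[of v]]
    by linarith
  finally have "vnorm w * vnorm w \<le> (op_norm A * vnorm v) * vnorm w"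
    by (simp add: ac_simps)
  then have "vnorm w \<le> op_norm A * vnorm v" if "0 < vnorm w"
    using that by simp
  moreover have "0 \<le> op_norm A * vnorm v"
    using op_norm_nonneg[OF A] vnorm_nonneg by simp
  ultimately show ?thesis
    using vnorm_nonneg[of w] by (cases "vnorm w = 0") (auto simp: w_def)
qed

section \<open>Kernels and column submatrices\<close>

lemma rank_deficient_kernel:
  fixes A :: "real mat"
  assumes A: "A \<in> carrier_mat m k" and rk: "vec_space.rank m A \<noteq> k"
  obtains v where "v \<in> carrier_vec k" "v \<noteq> 0\<^sub>v k" "A *\<^sub>v v = 0\<^sub>v m"
proof (cases "distinct (cols A)")
  case True
  then have "module.lin_dep class_ring (module_vec TYPE(real) m) (set (cols A))"
    using vec_space.lin_indpt_full_rank[OF A True] rk by blast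
  then show thesis
    using vec_space.lin_depE[OF A _ True] that by blast
next
  \<comment> \<open>Linear independence of \<open>set (cols A)\<close> does not notice repeated
    columns; they yield the kernel vector e_i - e_j directly.\<close>
  case False
  then obtain i j where ij: "i < k" "j < k" "i \<noteq> j" "col A i = col A j"
    using A by (auto simp: distinct_conv_nth)
  have col: "A *\<^sub>v unit_vec k i = col A i" if "i < k" for i
    using A that by (intro eq_vecI) auto
  define v :: "real vec" where "v = unit_vec k i - unit_vec k j"
  have "A *\<^sub>v v = A *\<^sub>v unit_vec k i - A *\<^sub>v unit_vec k j"
    unfolding v_def using A by (intro mult_minus_distrib_mat_vec) auto
  also have "\<dots> = 0\<^sub>v m"
    using A ij by (simp add: col)
  finally have "A *\<^sub>v v = 0\<^sub>v m" .
  moreover have "v $ i = 1"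
    using ij by (simp add: v_def)
  then have "v \<noteq> 0\<^sub>v k"
    using ij by auto
  moreover have "v \<in> carrier_vec k"
    by (simp add: v_def)
  ultimately show thesis
    using that by blast
qed

text \<open>\<open>pick J\<close> is the increasing enumeration of J that \<open>submatrix\<close>
  uses, so the entries line up with the columns of \<open>colsub A J\<close>.\<close>

definition subvec :: "real vec \<Rightarrow> nat set \<Rightarrow> real vec" where
  "subvec x J = vec (card J) (\<lambda>i. x $ pick J i)"

lemma bij_betw_pick:
  assumes "finite J"
  shows "bij_betw (pick J) {0..<card J} J"
proof -
  \<comment> \<open>The index i is recovered from \<open>pick J i\<close> as the number of elements
    of J below it.\<close>
  have "inj_on (pick J) {0..<card J}"
    by (rule inj_onI) (metis atLeastLessThan_iff card_pick_le)
  moreover have "pick J ` {0..<card J} \<subseteq> J"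
    using pick_in_set_le by auto
  ultimately show ?thesis
    using assms by (metis bij_betw_def card_atLeastLessThan card_image card_subset_eq diff_zero)
qed

context
  fixes A :: "real mat" and m n :: nat and J :: "nat set"
  assumes A: "A \<in> carrier_mat m n" and J: "J \<subseteq> {0..<n}"
begin

lemma colsub_index_set: "{j. j < dim_col A \<and> j \<in> J} = J"
  using A J by auto

lemma colsub_carrier: "colsub A J \<in> carrier_mat m (card J)"
  using A by (intro carrier_matI) (auto simp: colsub_def dim_submatrix colsub_index_set)

lemma sum_pick:
  assumes "\<And>j. j < n \<Longrightarrow> j \<notin> J \<Longrightarrow> f j = 0"
  shows "(\<Sum>i\<in>{0..<card J}. f (pick J i)) = (\<Sum>j\<in>{0..<n}. f j :: real)"
proof -
  have "(\<Sum>i\<in>{0..<card J}. f (pick J i)) = (\<Sum>j\<in>J. f j)"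
    using J by (intro sum.reindex_bij_betw bij_betw_pick) (auto intro: finite_subset)
  also have "\<dots> = (\<Sum>j\<in>{0..<n}. f j)"
    using J assms by (intro sum.mono_neutral_left) auto
  finally show ?thesis .
qed

text \<open>Bounds for a column submatrix thereby apply to vectors of full length n that vanish
  outside J, so the parts belonging to B and N can be added in one space.\<close>

lemma colsub_mult_subvec:
  assumes x: "x \<in> carrier_vec n" and supp: "\<And>j. j < n \<Longrightarrow> j \<notin> J \<Longrightarrow> x $ j = 0"
  shows "colsub A J *\<^sub>v subvec x J = A *\<^sub>v x"
proof (rule eq_vecI)
  fix i assume "i < dim_vec (A *\<^sub>v x)"
  then have i: "i < m"
    using A by simp
  have "(colsub A J *\<^sub>v subvec x J) $ i = (\<Sum>j\<in>{0..<card J}. A $$ (i, pick J j) * x $ pick J j)"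
  proof -
    have "colsub A J $$ (i, j) = A $$ (i, pick J j)" if "j < card J" for j
      unfolding colsub_def using A i that
      by (subst submatrix_index) (auto simp: colsub_index_set pick_UNIV)
    then show ?thesis
      using i colsub_carrier by (simp add: subvec_def scalar_prod_def)
  qed
  also have "\<dots> = (\<Sum>j\<in>{0..<n}. A $$ (i, j) * x $ j)"
    by (rule sum_pick) (simp add: supp)
  also have "\<dots> = (A *\<^sub>v x) $ i"
    using A x i by (simp add: scalar_prod_def)
  finally show "(colsub A J *\<^sub>v subvec x J) $ i = (A *\<^sub>v x) $ i" .
qed (use A colsub_carrier in simp)

lemma vnorm_subvec:
  assumes x: "x \<in> carrier_vec n" and supp: "\<And>j. j < n \<Longrightarrow> j \<notin> J \<Longrightarrow> x $ j = 0"
  shows "vnorm (subvec x J) = vnorm x"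
  using sum_pick[of "\<lambda>j. x $ j * x $ j"] x supp by (simp add: vnorm_def scalar_prod_def subvec_def)

lemma subvec_surj:
  assumes z: "z \<in> carrier_vec (card J)"
  obtains x where "x \<in> carrier_vec n" "\<And>j. j < n \<Longrightarrow> j \<notin> J \<Longrightarrow> x $ j = 0" "subvec x J = z"
proof
  let ?x = "vec n (\<lambda>j. if j \<in> J then z $ card {a \<in> J. a < j} else 0)"
  have "pick J i \<in> J" "pick J i < n" if "i < card J" for i
    using pick_in_set_le[OF that] J by auto
  then show "subvec ?x J = z"
    using z by (intro eq_vecI) (auto simp: subvec_def card_pick_le)
qed auto

lemma colsub_rank_deficient_kernel:
  assumes "vec_space.rank m (colsub A J) \<noteq> card J"
  obtains x where "x \<in> carrier_vec n" "x \<noteq> 0\<^sub>v n" "\<And>j. j < n \<Longrightarrow> j \<notin> J \<Longrightarrow> x $ j = 0"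
    "A *\<^sub>v x = 0\<^sub>v m"
proof -
  obtain z where z: "z \<in> carrier_vec (card J)" "z \<noteq> 0\<^sub>v (card J)" "colsub A J *\<^sub>v z = 0\<^sub>v m"
    using rank_deficient_kernel[OF colsub_carrier assms] .
  obtain x where x: "x \<in> carrier_vec n" "\<And>j. j < n \<Longrightarrow> j \<notin> J \<Longrightarrow> x $ j = 0" "subvec x J = z"
    using subvec_surj[OF z(1)] by blast
  have "vnorm x \<noteq> 0"
    using z(1,2) vnorm_zero_iff[OF z(1)] vnorm_subvec[OF x(1,2)] x(3) by simp
  then have "x \<noteq> 0\<^sub>v n"
    using vnorm_zero_iff[OF x(1)] by simp
  moreover have "A *\<^sub>v x = 0\<^sub>v m"
    using colsub_mult_subvec[OF x(1,2)] x(3) z(3) by simp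
  ultimately show thesis
    using that x by blast
qed

end

section \<open>Diagonal scalings and normal matrices\<close>

lemma diag_of_carrier: "x \<in> carrier_vec n \<Longrightarrow> diag_of x \<in> carrier_mat n n"
  by (auto simp: diag_of_def)

lemma diag_of_mult_vec:
  assumes "x \<in> carrier_vec n" "v \<in> carrier_vec n"
  shows "diag_of x *\<^sub>v v = vec n (\<lambda>i. x $ i * v $ i)"
proof (rule eq_vecI)
  fix i assume "i < dim_vec (vec n (\<lambda>i. x $ i * v $ i))"
  then have i: "i < n" by simp
  have "(diag_of x *\<^sub>v v) $ i = (\<Sum>j\<in>{0..<n}. (if i = j then x $ j else 0) * v $ j)"
    using assms i by (simp add: diag_of_def mat_diag_def scalar_prod_def)
  also have "\<dots> = (\<Sum>j\<in>{0..<n}. if j = i then x $ i * v $ j else 0)"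
    by (rule sum.cong) auto
  finally show "(diag_of x *\<^sub>v v) $ i = vec n (\<lambda>i. x $ i * v $ i) $ i"
    using i by simp
qed (use assms in \<open>simp add: diag_of_def mat_diag_def\<close>)

lemma vnorm_diag_mult_le:
  assumes "x \<in> carrier_vec n" "v \<in> carrier_vec n" "\<And>i. i < n \<Longrightarrow> \<bar>x $ i\<bar> \<le> r" "0 \<le> r"
  shows "vnorm (diag_of x *\<^sub>v v) \<le> r * vnorm v"
proof -
  have "vnorm (diag_of x *\<^sub>v v) = L2_set (\<lambda>i. \<bar>x $ i * v $ i\<bar>) {0..<n}"
    using assms by (simp add: diag_of_mult_vec vnorm_eq_L2_set L2_set_def)
  also have "\<dots> \<le> L2_set (\<lambda>i. r * \<bar>v $ i\<bar>) {0..<n}"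
    using assms by (intro L2_set_mono) (auto simp: abs_mult mult_right_mono)
  also have "\<dots> = r * vnorm v"
    using assms by (simp add: vnorm_eq_L2_set L2_set_right_distrib[symmetric]) (simp add: L2_set_def)
  finally show ?thesis .
qed

text \<open>The normal matrix is the Gram matrix of X A^T, which makes it symmetric and its form a
  squared norm.\<close>

lemma normal_mat_props:
  assumes A: "A \<in> carrier_mat m n" and x: "x \<in> carrier_vec n"
  shows "normal_mat A x \<in> carrier_mat m m"
    and "transpose_mat (normal_mat A x) = normal_mat A x"
    and "v \<in> carrier_vec m \<Longrightarrow>
      v \<bullet> (normal_mat A x *\<^sub>v v) = (vnorm (diag_of x *\<^sub>v (transpose_mat A *\<^sub>v v)))\<^sup>2"
proof -
  define T where "T = diag_of x * transpose_mat A"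
  have D: "diag_of x \<in> carrier_mat n n"
    using x by (rule diag_of_carrier)
  have T: "T \<in> carrier_mat n m"
    using A D by (simp add: T_def)
  have "transpose_mat (diag_of x) = diag_of x"
    by (intro eq_matI) (auto simp: diag_of_def mat_diag_def)
  then have "transpose_mat T = A * diag_of x"
    using transpose_mult[OF D, of "transpose_mat A" m] A by (simp add: T_def)
  then have "normal_mat A x = transpose_mat T * T"
    using A D unfolding normal_mat_def T_def
    by (simp add: assoc_mult_mat[of A m n _ n _ m] assoc_mult_mat[of _ n n _ n _ m])
  then show "normal_mat A x \<in> carrier_mat m m"
    and "transpose_mat (normal_mat A x) = normal_mat A x"
    and "v \<in> carrier_vec m \<Longrightarrow>
      v \<bullet> (normal_mat A x *\<^sub>v v) = (vnorm (diag_of x *\<^sub>v (transpose_mat A *\<^sub>v v)))\<^sup>2"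
    using Gram_mat_props[OF T] A D by (auto simp: T_def)
qed

lemma normal_mat_psd:
  assumes "A \<in> carrier_mat m n" "x \<in> carrier_vec n"
  shows "sym_psd (normal_mat A x)"
  using normal_mat_props[OF assms] by (auto simp: sym_psd_def)

section \<open>Optimal solutions along a run of the method\<close>

text \<open>The ratio test of the simplex method: t is the largest step that keeps x + t d
  nonnegative, and a coordinate attaining the minimal ratio becomes 0. No new coordinate enters the
  support, because d vanishes where x does.\<close>

lemma reduce_support_neg:
  assumes x: "x \<in> carrier_vec n" "\<And>j. j < n \<Longrightarrow> 0 \<le> x $ j"
    and d: "d \<in> carrier_vec n" "\<And>j. j < n \<Longrightarrow> x $ j = 0 \<Longrightarrow> d $ j = 0"
    and neg: "j < n" "d $ j < 0"
  obtains t where "\<And>j. j < n \<Longrightarrow> 0 \<le> (x + t \<cdot>\<^sub>v d) $ j" "supp (x + t \<cdot>\<^sub>v d) \<subset> supp x"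
proof -
  define S where "S = {j. j < n \<and> d $ j < 0}"
  define t where "t = Min ((\<lambda>j. x $ j / - d $ j) ` S)"
  have S: "finite S" "S \<noteq> {}"
    using neg by (auto simp: S_def)
  then have "t \<in> (\<lambda>j. x $ j / - d $ j) ` S"
    unfolding t_def by (intro Min_in) auto
  then obtain i where i: "i < n" "d $ i < 0" "t = x $ i / - d $ i"
    by (auto simp: S_def)
  then have t: "0 \<le> t"
    using x(2)[of i] by (simp add: divide_nonneg_neg)
  have "0 \<le> (x + t \<cdot>\<^sub>v d) $ j" if j: "j < n" for j
  proof (cases "d $ j < 0")
    case True
    then have "t \<le> x $ j / - d $ j"
      unfolding t_def using j S by (intro Min_le) (auto simp: S_def)
    then show ?thesis
      using True j x(1) d(1) by (simp add: field_simps)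
  next
    case False
    then show ?thesis
      using t j x d(1) by simp
  qed
  moreover have "supp (x + t \<cdot>\<^sub>v d) \<subset> supp x"
  proof
    show "supp (x + t \<cdot>\<^sub>v d) \<subseteq> supp x"
      using x(1) d by (auto simp: supp_def)
    have "i \<in> supp x"
      using i x(1) d(2)[of i] by (auto simp: supp_def)
    moreover have "i \<notin> supp (x + t \<cdot>\<^sub>v d)"
      using i x(1) d(1) by (simp add: supp_def field_simps)
    ultimately show "supp (x + t \<cdot>\<^sub>v d) \<noteq> supp x"
      by blast
  qed
  ultimately show thesis
    using that by blast
qed

text \<open>A nonzero entry of d is negative in d or in -d, and t may have either sign.\<close>

lemma reduce_support:
  assumes x: "x \<in> carrier_vec n" "\<And>j. j < n \<Longrightarrow> 0 \<le> x $ j"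
    and d: "d \<in> carrier_vec n" "\<And>j. j < n \<Longrightarrow> x $ j = 0 \<Longrightarrow> d $ j = 0" and nz: "d \<noteq> 0\<^sub>v n"
  obtains t where "\<And>j. j < n \<Longrightarrow> 0 \<le> (x + t \<cdot>\<^sub>v d) $ j" "supp (x + t \<cdot>\<^sub>v d) \<subset> supp x"
proof -
  obtain j where j: "j < n" "d $ j \<noteq> 0"
    using d(1) nz by (metis carrier_vecD eq_vecI index_zero_vec)
  show thesis
  proof (cases "d $ j < 0")
    case True
    then show ?thesis
      using reduce_support_neg[OF x d j(1)] that by blast
  next
    case False
    have "(- 1 :: real) \<cdot>\<^sub>v d \<in> carrier_vec n"
      using d by simp
    moreover have "((- 1 :: real) \<cdot>\<^sub>v d) $ j < 0"
      using False j d(1) by simp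
    moreover have "((- 1 :: real) \<cdot>\<^sub>v d) $ j = 0" if "j < n" "x $ j = 0" for j
      using that d by simp
    ultimately obtain t where t: "\<And>j. j < n \<Longrightarrow> 0 \<le> (x + t \<cdot>\<^sub>v ((- 1) \<cdot>\<^sub>v d)) $ j"
      "supp (x + t \<cdot>\<^sub>v ((- 1) \<cdot>\<^sub>v d)) \<subset> supp x"
      using reduce_support_neg[OF x, of "(- 1) \<cdot>\<^sub>v d" j] j(1) by blast
    then show ?thesis
      using that[of "- t"] by (simp add: smult_smult_assoc)
  qed
qed

section \<open>Duality gaps, complementarity and the optimal partition\<close>

lemma duality_gap:
  fixes A :: "real mat"
  assumes A: "A \<in> carrier_mat m n" and "x \<in> carrier_vec n" "y \<in> carrier_vec m" "s \<in> carrier_vec n"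
    and "transpose_mat A *\<^sub>v y + s = c"
  shows "c \<bullet> x = (A *\<^sub>v x) \<bullet> y + s \<bullet> x"
proof -
  have "c \<bullet> x = (transpose_mat A *\<^sub>v y) \<bullet> x + s \<bullet> x"
    using assms by (metis add_scalar_prod_distrib mult_mat_vec_carrier transpose_carrier_mat)
  also have "(transpose_mat A *\<^sub>v y) \<bullet> x = (A *\<^sub>v x) \<bullet> y"
    using transpose_vec_mult_scalar[OF A] assms comm_scalar_prod[of y m "A *\<^sub>v x"] by simp
  finally show ?thesis .
qed

lemma scalar_prod_nonneg:
  assumes "v \<in> carrier_vec n" "\<And>j. j < n \<Longrightarrow> 0 \<le> u $ j" "\<And>j. j < n \<Longrightarrow> 0 \<le> v $ j"
  shows "0 \<le> u \<bullet> (v :: real vec)"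
  using assms by (auto simp: scalar_prod_def intro!: sum_nonneg)

lemma scalar_prod_nonneg_eq_0:
  assumes "v \<in> carrier_vec n" "\<And>j. j < n \<Longrightarrow> 0 \<le> u $ j" "\<And>j. j < n \<Longrightarrow> 0 \<le> v $ j"
    and "u \<bullet> (v :: real vec) \<le> 0" and j: "j < n"
  shows "u $ j * v $ j = 0"
proof -
  have "(\<Sum>j\<in>{0..<n}. u $ j * v $ j) = 0"
    using scalar_prod_nonneg[of v n u] assms by (intro antisym) (auto simp: scalar_prod_def)
  then show ?thesis
    using assms by (subst (asm) sum_nonneg_eq_0_iff) auto
qed

locale primal_ipm_run =
  fixes m n :: nat and A :: "real mat" and b c xs ss :: "real vec" and \<tau> :: real
    and x :: "nat \<Rightarrow> real vec" and \<mu> :: "nat \<Rightarrow> real"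
  assumes run: "ipm_run m n A b c xs ss \<tau> x \<mu>"
begin

abbreviation "B \<equiv> part_B A b c"
abbreviation "N \<equiv> part_N A b c"

lemma dims: "1 \<le> m" "1 \<le> n" "A \<in> carrier_mat m n" "b \<in> carrier_vec m" "c \<in> carrier_vec n"
  "dim_row A = m" "dim_col A = n"
  using run by (auto simp: ipm_run_def)

lemma A1: "A1 A b c" and A2: "A2 A b c" and N_nonempty: "N \<noteq> {}"
  and strictly_compl: "strictly_complementary A b c xs ss"
  and ipm: "primal_ipm A b c \<tau> x \<mu>"
  and delta_le: "\<And>k. 1 \<le> k \<Longrightarrow> delta A c (x k) (\<mu> k) \<le> sqrt 2 / 2"
  using run unfolding ipm_run_def by blast+

lemma tau_pos: "0 < \<tau>" and tau_less_1: "\<tau> < 1"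
  using ipm by (auto simp: primal_ipm_def)

lemma mu_eq: "1 \<le> k \<Longrightarrow> \<mu> k = (1 - \<tau>) ^ (k - 1) * \<mu> 1"
proof (induction k rule: dec_induct)
  case (step k)
  then have "\<mu> (Suc k) = (1 - \<tau>) * \<mu> k"
    using ipm unfolding primal_ipm_def by blast
  then show ?case
    using step by (cases k) auto
qed simp

lemma mu_1_pos: "0 < \<mu> 1"
  using ipm by (auto simp: primal_ipm_def)

lemma mu_pos: "1 \<le> k \<Longrightarrow> 0 < \<mu> k"
  using mu_1_pos tau_less_1 by (subst mu_eq) auto

lemma mu_antimono: "1 \<le> k \<Longrightarrow> k \<le> j \<Longrightarrow> \<mu> j \<le> \<mu> k"
proof -
  assume "1 \<le> k" "k \<le> j"
  moreover have "(1 - \<tau>) ^ (j - 1) * \<mu> 1 \<le> (1 - \<tau>) ^ (k - 1) * \<mu> 1" if "k \<le> j"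
    using that mu_1_pos tau_pos tau_less_1 by (intro mult_right_mono power_decreasing) auto
  ultimately show "\<mu> j \<le> \<mu> k"
    using mu_eq[of k] mu_eq[of j] by simp
qed

lemma mu_eventually_le:
  assumes "0 < e"
  shows "\<exists>k\<ge>1. \<mu> k \<le> e"
proof -
  obtain l where "(1 - \<tau>) ^ l < e / \<mu> 1"
    using real_arch_pow_inv[of "e / \<mu> 1" "1 - \<tau>"] assms mu_1_pos tau_pos by auto
  then have "\<mu> (Suc l) \<le> e"
    using mu_1_pos mu_eq[of "Suc l"] by (simp add: field_simps)
  then show ?thesis
    by (intro exI[of _ "Suc l"]) auto
qed

lemma FpD:
  assumes "z \<in> Fp A b"
  shows "z \<in> carrier_vec n" "A *\<^sub>v z = b" "\<And>j. j < n \<Longrightarrow> 0 \<le> z $ j"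
  using assms dims by (auto simp: Fp_def)

lemma FdD:
  assumes "(y, s) \<in> Fd A c"
  shows "y \<in> carrier_vec m" "s \<in> carrier_vec n" "transpose_mat A *\<^sub>v y + s = c"
    "\<And>j. j < n \<Longrightarrow> 0 \<le> s $ j"
  using assms dims by (auto simp: Fd_def)

lemma iterate_Fp0: "1 \<le> k \<Longrightarrow> x k \<in> Fp0 A b"
proof (induction k rule: dec_induct)
  case (step k)
  then show ?case
    using ipm unfolding primal_ipm_def by blast
qed (use ipm in \<open>simp add: primal_ipm_def\<close>)

lemma iterate:
  assumes "1 \<le> k"
  shows "x k \<in> Fp A b" "\<And>j. j < n \<Longrightarrow> 0 < x k $ j"
  using iterate_Fp0[OF assms] dims by (auto simp: Fp0_def)

lemma gap_eq:
  assumes "z \<in> Fp A b" "(y, s) \<in> Fd A c"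
  shows "c \<bullet> z = b \<bullet> y + s \<bullet> z"
  using duality_gap[OF dims(3) FpD(1)[OF assms(1)] FdD(1-3)[OF assms(2)]] FpD(2)[OF assms(1)]
  by simp

text \<open>The Euclidean norm dominates each coordinate, so proximity below 1 forces s_j x_j /
  \<mu> - 1 \<le> 1 for every j; the n products, each at most 2 \<mu>, add up to the gap.\<close>

lemma iterate_gap:
  assumes k: "1 \<le> k"
  obtains y s where "(y, s) \<in> Fd A c" "s \<bullet> x k \<le> 2 * real n * \<mu> k"
proof -
  define f where "f = (\<lambda>(y :: real vec, s). vnorm ((1 / \<mu> k) \<cdot>\<^sub>v (diag_of (x k) *\<^sub>v s) - ones (dim_col A)))"
  have "Fd A c \<noteq> {}"
    using A1 by (auto simp: A1_def Fd0_def)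
  \<comment> \<open>The bound on \<open>delta\<close> concerns an infimum. The room between sqrt 2 /
    2 and 1 yields an actual dual point without an appeal to attainment.\<close>
  moreover have "Inf (f ` Fd A c) < 1"
  proof -
    have "Inf (f ` Fd A c) \<le> sqrt 2 / 2"
      using delta_le[OF k] by (simp add: delta_def f_def)
    also have "sqrt 2 / 2 < (1 :: real)"
      using real_sqrt_less_mono[of 2 4] by simp
    finally show ?thesis .
  qed
  ultimately obtain y s where ys: "(y, s) \<in> Fd A c" "f (y, s) < 1"
    using cInf_lessD[of "f ` Fd A c" 1] by auto
  define w where "w = (1 / \<mu> k) \<cdot>\<^sub>v (diag_of (x k) *\<^sub>v s) - ones n"
  have "diag_of (x k) *\<^sub>v s \<in> carrier_vec n"
    using diag_of_carrier[OF FpD(1)[OF iterate(1)[OF k]]] FdD(2)[OF ys(1)] by (rule mult_mat_vec_carrier)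
  then have w: "w \<in> carrier_vec n"
    unfolding w_def ones_def by (intro minus_carrier_vec) auto
  have norm_w: "vnorm w \<le> 1"
    using ys(2) unfolding f_def w_def dims(7) prod.case by (rule less_imp_le)
  have w_index: "w $ j = s $ j * x k $ j / \<mu> k - 1" if "j < n" for j
    using that FdD(2)[OF ys(1)] FpD(1)[OF iterate(1)[OF k]]
    by (simp add: w_def ones_def diag_of_mult_vec)
  have "(s \<bullet> x k) / \<mu> k = (\<Sum>j\<in>{0..<n}. w $ j + 1)"
    using FpD(1)[OF iterate(1)[OF k]] by (simp add: w_index scalar_prod_def sum_divide_distrib)
  also have "\<dots> \<le> (\<Sum>j\<in>{0..<n}. 2)"
  proof (rule sum_mono)
    fix j assume "j \<in> {0..<n}"
    then show "w $ j + 1 \<le> 2"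
      using abs_index_le_vnorm[of j w] w norm_w by auto
  qed
  finally have "s \<bullet> x k \<le> 2 * real n * \<mu> k"
    using mu_pos[OF k] by (simp add: field_simps)
  with ys(1) show thesis
    by (rule that)
qed

lemma xs_optimal: "xs \<in> primal_optimal A b c"
  and xs_ss_pos: "\<And>j. j < n \<Longrightarrow> 0 < xs $ j + ss $ j"
  using strictly_compl unfolding strictly_complementary_def optimal_pairs_def dims(7) by auto

lemma xs: "xs \<in> carrier_vec n" "A *\<^sub>v xs = b" "\<And>j. j < n \<Longrightarrow> 0 \<le> xs $ j"
  using FpD[of xs] xs_optimal by (simp_all add: primal_optimal_def)

lemma ss_optimal: obtains ys where "(ys, ss) \<in> dual_optimal A b c"
  using strictly_compl unfolding strictly_complementary_def optimal_pairs_def by auto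

lemma ss: "ss \<in> carrier_vec n" "\<And>j. j < n \<Longrightarrow> 0 \<le> ss $ j"
proof -
  obtain ys where "(ys, ss) \<in> dual_optimal A b c"
    using ss_optimal .
  then have "(ys, ss) \<in> Fd A c"
    by (simp add: dual_optimal_def)
  then show "ss \<in> carrier_vec n" "\<And>j. j < n \<Longrightarrow> 0 \<le> ss $ j"
    by (rule FdD)+
qed

text \<open>For fixed x the gap is c.x - b.y, and the optimal dual solution makes it smallest among
  all dual feasible points.\<close>

lemma ss_iterate:
  assumes k: "1 \<le> k"
  shows "ss \<bullet> x k \<le> 2 * real n * \<mu> k"
proof -
  obtain ys where "(ys, ss) \<in> dual_optimal A b c"
    using ss_optimal .
  then have ys: "(ys, ss) \<in> Fd A c" "\<And>y s. (y, s) \<in> Fd A c \<Longrightarrow> b \<bullet> y \<le> b \<bullet> ys"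
    unfolding dual_optimal_def by auto
  obtain y s where d: "(y, s) \<in> Fd A c" "s \<bullet> x k \<le> 2 * real n * \<mu> k"
    using iterate_gap[OF k] .
  show ?thesis
    using gap_eq[OF iterate(1)[OF k] ys(1)] gap_eq[OF iterate(1)[OF k] d(1)] ys(2)[OF d(1)] d(2)
    by linarith
qed

text \<open>Strong duality comes for free: the duality gaps of the iterates tend to \<open>0\<close> with \<open>\<mu>\<close>.\<close>

lemma optimal_complementary:
  assumes z: "z \<in> primal_optimal A b c" and d: "(y, s) \<in> dual_optimal A b c" and j: "j < n"
  shows "s $ j * z $ j = 0"
proof -
  have Fz: "z \<in> Fp A b" and Fd: "(y, s) \<in> Fd A c"
    using z d by (auto simp: primal_optimal_def dual_optimal_def)
  have "s \<bullet> z \<le> 2 * real n * \<mu> k" if k: "1 \<le> k" for k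
  proof -
    obtain y' s' where ys': "(y', s') \<in> Fd A c" "s' \<bullet> x k \<le> 2 * real n * \<mu> k"
      using iterate_gap[OF k] .
    have "c \<bullet> z \<le> c \<bullet> x k" "b \<bullet> y' \<le> b \<bullet> y"
      using z d ys' iterate(1)[OF k] by (auto simp: primal_optimal_def dual_optimal_def)
    then show ?thesis
      using gap_eq[OF Fz Fd] gap_eq[OF iterate(1)[OF k] ys'(1)] ys'(2) by linarith
  qed
  then have "s \<bullet> z \<le> e" if "0 < e" for e
    using mu_eventually_le[of "e / (2 * real n)"] that dims(2)
    by (auto simp: field_simps intro: order_trans)
  then have "s \<bullet> z \<le> 0"
    by (rule field_le_epsilon[of _ 0, simplified])
  then show ?thesis
    using FpD[OF Fz] FdD[OF Fd] j by (intro scalar_prod_nonneg_eq_0[of z n s]) auto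
qed

lemma primal_optimal_zero_off_B:
  assumes "z \<in> primal_optimal A b c" "j < n" "z $ j \<noteq> 0"
  shows "j \<in> B"
proof -
  obtain ys where "(ys, ss) \<in> dual_optimal A b c"
    using ss_optimal .
  then have "(z, ss) \<in> optimal_pairs A b c"
    using assms(1) unfolding optimal_pairs_def by blast
  moreover have "0 < z $ j"
    using assms FpD(3)[of z j] by (simp add: primal_optimal_def less_le)
  ultimately show ?thesis
    using assms(2) dims(7) unfolding part_B_def by blast
qed

text \<open>A single strictly complementary pair already realizes the whole partition: if some
  optimal z has z_j > 0, complementarity with \<open>ss\<close> gives ss_j = 0, and strict
  complementarity then gives xs_j > 0. The argument for N is symmetric.\<close>

lemma B_eq: "B = {j. j < n \<and> 0 < xs $ j}"
  and N_eq: "N = {j. j < n \<and> 0 < ss $ j}"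
proof -
  have ss0: "z $ j = 0 \<or> ss $ j = 0" if "z \<in> primal_optimal A b c" "j < n" for z j
  proof -
    obtain ys where "(ys, ss) \<in> dual_optimal A b c"
      using ss_optimal .
    then show ?thesis
      using optimal_complementary[OF that(1) _ that(2)] by auto
  qed
  have xs0: "s $ j = 0 \<or> xs $ j = 0" if "(y, s) \<in> dual_optimal A b c" "j < n" for y s j
    using optimal_complementary[OF xs_optimal that] by simp
  have pos: "xs $ j \<noteq> 0 \<Longrightarrow> 0 < xs $ j" "ss $ j \<noteq> 0 \<Longrightarrow> 0 < ss $ j" if "j < n" for j
    using xs(3)[OF that] ss(2)[OF that] by auto
  show "B = {j. j < n \<and> 0 < xs $ j}"
  proof (intro equalityI subsetI)
    fix j assume "j \<in> B"
    then obtain z where "j < n" "z \<in> primal_optimal A b c" "0 < z $ j"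
      unfolding part_B_def optimal_pairs_def dims(7) by blast
    then show "j \<in> {j. j < n \<and> 0 < xs $ j}"
      using ss0[of z j] xs_ss_pos[of j] by auto
  next
    fix j assume "j \<in> {j. j < n \<and> 0 < xs $ j}"
    then show "j \<in> B"
      using primal_optimal_zero_off_B[OF xs_optimal] by auto
  qed
  show "N = {j. j < n \<and> 0 < ss $ j}"
  proof (intro equalityI subsetI)
    fix j assume "j \<in> N"
    then obtain y s where "j < n" "(y, s) \<in> dual_optimal A b c" "0 < s $ j"
      unfolding part_N_def optimal_pairs_def dims(7) by blast
    then show "j \<in> {j. j < n \<and> 0 < ss $ j}"
      using xs0[of y s j] xs_ss_pos[of j] by auto
  next
    fix j assume "j \<in> {j. j < n \<and> 0 < ss $ j}"
    moreover have "(xs, ss) \<in> optimal_pairs A b c"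
      using strictly_compl by (simp add: strictly_complementary_def)
    ultimately show "j \<in> N"
      unfolding part_N_def dims(7) by blast
  qed
qed

lemma B_or_N: "j < n \<Longrightarrow> j \<in> B \<longleftrightarrow> j \<notin> N"
  and xs_off_B: "j < n \<Longrightarrow> j \<notin> B \<Longrightarrow> xs $ j = 0"
proof -
  assume j: "j < n"
  obtain ys where "(ys, ss) \<in> dual_optimal A b c"
    using ss_optimal .
  then have "ss $ j * xs $ j = 0"
    using optimal_complementary[OF xs_optimal _ j] by blast
  then show "j \<in> B \<longleftrightarrow> j \<notin> N"
    using j xs_ss_pos[OF j] by (auto simp: B_eq N_eq)
  show "j \<notin> B \<Longrightarrow> xs $ j = 0"
    using xs(3)[OF j] j by (auto simp: B_eq)
qed

lemma B_subset: "B \<subseteq> {0..<n}" and N_subset: "N \<subseteq> {0..<n}" and card_B: "card B = m"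
  using A2 dims(6) by (auto simp: B_eq N_eq A2_def)

text \<open>An optimal point of minimal support is basic, so its support is \<open>B\<close> by nondegeneracy.\<close>

lemma det_colsub_B: "det (colsub A B) \<noteq> 0"
proof -
  obtain z where z: "z \<in> primal_optimal A b c"
    and min: "\<And>z'. z' \<in> primal_optimal A b c \<Longrightarrow> card (supp z) \<le> card (supp z')"
    using ex_has_least_nat[of "\<lambda>z. z \<in> primal_optimal A b c" xs "\<lambda>z. card (supp z)"] xs_optimal by blast
  have Fz: "z \<in> Fp A b"
    using z by (simp add: primal_optimal_def)
  note z_Fp = FpD[OF Fz]
  obtain ys where ys: "(ys, ss) \<in> dual_optimal A b c"
    using ss_optimal .
  then have Fd: "(ys, ss) \<in> Fd A c"
    by (simp add: dual_optimal_def)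
  have supp: "supp z \<subseteq> {0..<n}"
    using z_Fp by (auto simp: supp_def)
  have "vec_space.rank m (colsub A (supp z)) = card (supp z)"
  proof (rule ccontr)
    assume "vec_space.rank m (colsub A (supp z)) \<noteq> card (supp z)"
    then obtain d where d: "d \<in> carrier_vec n" "d \<noteq> 0\<^sub>v n" "A *\<^sub>v d = 0\<^sub>v m"
      and d0: "\<And>j. j < n \<Longrightarrow> j \<notin> supp z \<Longrightarrow> d $ j = 0"
      using colsub_rank_deficient_kernel[OF dims(3) supp] by blast
    have d0': "d $ j = 0" if "j < n" "z $ j = 0" for j
      using d0[of j] that z_Fp(1) by (simp add: supp_def)
    obtain t where t: "\<And>j. j < n \<Longrightarrow> 0 \<le> (z + t \<cdot>\<^sub>v d) $ j" "supp (z + t \<cdot>\<^sub>v d) \<subset> supp z"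
      using reduce_support[OF z_Fp(1,3) d(1) d0' d(2)] by blast
    define z' where "z' = z + t \<cdot>\<^sub>v d"
    have "A *\<^sub>v z' = b + t \<cdot>\<^sub>v 0\<^sub>v m"
      using mult_add_distrib_mat_vec[OF dims(3) z_Fp(1), of "t \<cdot>\<^sub>v d"] mult_mat_vec[OF dims(3) d(1)] d z_Fp(2)
      by (simp add: z'_def)
    also have "\<dots> = b"
      using dims(4) by (intro eq_vecI) auto
    finally have Fz': "z' \<in> Fp A b"
      using t(1) z_Fp(1) d(1) dims by (simp add: Fp_def z'_def)
    \<comment> \<open>The support of \<open>z'\<close> lies within that of z, so \<open>z'\<close>
      stays complementary to \<open>ss\<close>. Its objective value is then b.ys, a lower bound for
      the value of z, and \<open>z'\<close> is optimal again, against the minimality of the support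
      of z.\<close>
    have "ss $ j * z' $ j = 0" if j: "j < n" for j
      using optimal_complementary[OF z ys j] d0'[OF j] j z_Fp(1) d(1) by (auto simp: z'_def)
    then have "ss \<bullet> z' = 0"
      using FpD(1)[OF Fz'] unfolding scalar_prod_def by (intro sum.neutral) auto
    moreover have "0 \<le> ss \<bullet> z"
      using z_Fp ss(2) by (intro scalar_prod_nonneg) auto
    ultimately have "c \<bullet> z' \<le> c \<bullet> z"
      using gap_eq[OF Fz Fd] gap_eq[OF Fz' Fd] by simp
    then have "z' \<in> primal_optimal A b c"
      using z Fz' by (fastforce simp: primal_optimal_def)
    then have "card (supp z) \<le> card (supp z')"
      by (rule min)
    moreover have "card (supp z') < card (supp z)"
      using t(2) supp finite_subset by (intro psubset_card_mono) (auto simp: z'_def)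
    ultimately show False by simp
  qed
  then have rank: "vec_space.rank m (colsub A (supp z)) = card (supp z)" .
  then have "basic_feasible A b z"
    using Fz dims by (simp add: basic_feasible_def)
  then have card: "card (supp z) = m"
    using A2 z dims(6) by (simp add: A2_def primal_nondegenerate_def)
  have "supp z \<subseteq> B"
    using primal_optimal_zero_off_B[OF z] z_Fp(1) by (auto simp: supp_def)
  then have "supp z = B"
    using card card_B B_subset finite_subset by (metis card_subset_eq finite_atLeastLessThan)
  then show ?thesis
    using vec_space.det_rank_iff[of "colsub A B" m] colsub_carrier[OF dims(3) B_subset] card_B rank
    by simp
qed

end

section \<open>Convergence of the normal matrices\<close>

lemma diag_of_mult_split:
  assumes "u \<in> carrier_vec n" "v \<in> carrier_vec n" "w \<in> carrier_vec n"
  shows "diag_of u *\<^sub>v w = diag_of v *\<^sub>v w + diag_of (u - v) *\<^sub>v w"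
  using assms by (auto simp: diag_of_mult_vec[where n = n] algebra_simps)

lemma psd_invertible_lambda_min_pos:
  assumes M: "M \<in> carrier_mat n n" "sym_psd M" and det: "det M \<noteq> 0" and n: "0 < n"
  shows "0 < lambda_min M"
proof -
  obtain c where "0 < c" "\<And>v. v \<in> carrier_vec n \<Longrightarrow> c * (v \<bullet> v) \<le> v \<bullet> (M *\<^sub>v v)"
    using psd_invertible_pos_def[OF M det] by blast
  then show ?thesis
    using lambda_min_greatest[OF M(1) _ n, of c] M(2) by (simp add: sym_psd_def)
qed

section \<open>Positivity of the constants in the threshold\<close>

context primal_ipm_run
begin

abbreviation "A\<^sub>B \<equiv> colsub A B"

text \<open>The smallest singular value of A_B.\<close>

definition sigma :: real where
  "sigma = sqrt (lambda_min (transpose_mat A\<^sub>B * A\<^sub>B))"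

definition lam :: real where
  "lam = lambda_min (normal_mat A xs)"

lemma A\<^sub>B_carrier: "A\<^sub>B \<in> carrier_mat m m"
  using colsub_carrier[OF dims(3) B_subset] card_B by simp

lemma sigma_pos: "0 < sigma"
proof -
  note G = Gram_mat_props[OF A\<^sub>B_carrier]
  have "sym_psd (transpose_mat A\<^sub>B * A\<^sub>B)"
    using G A\<^sub>B_carrier by (auto simp: sym_psd_def)
  moreover have "det (transpose_mat A\<^sub>B * A\<^sub>B) \<noteq> 0"
    using det_colsub_B A\<^sub>B_carrier by (subst det_mult[of _ m]) (auto simp: det_transpose)
  ultimately show ?thesis
    using psd_invertible_lambda_min_pos[OF G(1)] dims(1) by (simp add: sigma_def)
qed

lemma sigma_le:
  assumes z: "z \<in> carrier_vec n" "\<And>j. j < n \<Longrightarrow> j \<notin> B \<Longrightarrow> z $ j = 0"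
  shows "sigma * vnorm z \<le> vnorm (A *\<^sub>v z)"
proof -
  define u where "u = subvec z B"
  note G = Gram_mat_props[OF A\<^sub>B_carrier]
  have u: "u \<in> carrier_vec m"
    by (simp add: u_def subvec_def card_B)
  have "sigma\<^sup>2 * (u \<bullet> u) \<le> u \<bullet> (transpose_mat A\<^sub>B * A\<^sub>B *\<^sub>v u)"
    using lambda_min_Rayleigh[OF G(1,2) _ u] dims(1) sigma_pos by (simp add: sigma_def)
  also have "\<dots> = (vnorm (A *\<^sub>v z))\<^sup>2"
    using G(3)[OF u] colsub_mult_subvec[OF dims(3) B_subset z] by (simp add: u_def)
  also have "u \<bullet> u = (vnorm z)\<^sup>2"
    using vnorm_subvec[OF dims(3) B_subset z] by (simp add: u_def flip: vnorm_power2)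
  finally have "(sigma * vnorm z)\<^sup>2 \<le> (vnorm (A *\<^sub>v z))\<^sup>2"
    by (simp add: power_mult_distrib)
  then show ?thesis
    using vnorm_nonneg by (rule power2_le_imp_le)
qed

text \<open>Because |B| = m \<ge> 1, some unit vector e_j has j in B, and \<open>sigma\<close> \<le>
  |A e_j| \<le> \<open>op_norm A\<close>.\<close>

lemma op_norm_pos: "0 < op_norm A"
proof -
  have "B \<noteq> {}"
    using card_B dims(1) by auto
  then obtain j where "j \<in> B"
    by blast
  then have j: "j \<in> B" "j < n"
    using B_subset by (meson atLeastLessThan_iff subsetD)+
  define z :: "real vec" where "z = unit_vec n j"
  have z: "z \<in> carrier_vec n" "\<And>i. i < n \<Longrightarrow> i \<notin> B \<Longrightarrow> z $ i = 0" "vnorm z = 1"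
    using j by (auto simp: z_def vnorm_def)
  then show ?thesis
    using sigma_le[OF z(1,2)] vnorm_mult_mat_le[OF dims(3) z(1)] sigma_pos by simp
qed

text \<open>Requiring nonzero entries only on B covers both the optimal solution and the iterates.
  If v is in the kernel, A^T v vanishes on B. As A_B is invertible, v = A y with y supported on B,
  hence v.v = (A^T v).y = 0.\<close>

lemma det_normal_mat:
  assumes z: "z \<in> carrier_vec n" "\<And>j. j \<in> B \<Longrightarrow> z $ j \<noteq> 0"
  shows "det (normal_mat A z) \<noteq> 0"
proof
  assume "det (normal_mat A z) = 0"
  then obtain v where v: "v \<in> carrier_vec m" "v \<noteq> 0\<^sub>v m" "normal_mat A z *\<^sub>v v = 0\<^sub>v m"
    using det_0_iff_vec_prod_zero_field[OF normal_mat_props(1)[OF dims(3) z(1)]] by blast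
  define w where "w = transpose_mat A *\<^sub>v v"
  have w: "w \<in> carrier_vec n"
    using dims(3) v by (auto simp: w_def)
  have "vnorm (diag_of z *\<^sub>v w) = 0"
    using normal_mat_props(3)[OF dims(3) z(1) v(1)] v by (simp add: w_def)
  then have zw: "z $ j * w $ j = 0" if "j < n" for j
    using vnorm_zero_iff[of "diag_of z *\<^sub>v w" n] diag_of_mult_vec[OF z(1) w] that
    by (metis index_vec index_zero_vec(1) vec_carrier)
  define u where "u = minv A\<^sub>B *\<^sub>v v"
  note inv = minv_inverts[OF A\<^sub>B_carrier det_colsub_B]
  have u: "u \<in> carrier_vec m" "A\<^sub>B *\<^sub>v u = v"
    using mult_mat_vec_carrier[OF inv(1) v(1)] assoc_mult_mat_vec[OF A\<^sub>B_carrier inv(1) v(1)] inv(2) v(1)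
    by (simp_all add: u_def)
  obtain y where y: "y \<in> carrier_vec n" "\<And>j. j < n \<Longrightarrow> j \<notin> B \<Longrightarrow> y $ j = 0" "subvec y B = u"
    using subvec_surj[OF dims(3) B_subset, of u] u(1) card_B by blast
  have "A *\<^sub>v y = v"
    using colsub_mult_subvec[OF dims(3) B_subset y(1,2)] y(3) u(2) by simp
  then have "v \<bullet> v = w \<bullet> y"
    using transpose_vec_mult_scalar[OF dims(3) y(1) v(1)] by (simp add: w_def)
  also have "\<dots> = 0"
    using zw y z(2) unfolding scalar_prod_def by (intro sum.neutral) force
  finally show False
    using scalar_prod_self_pos[OF v(1,2)] by simp
qed

lemma lam_pos: "0 < lam"
proof -
  have "det (normal_mat A xs) \<noteq> 0"
    by (rule det_normal_mat[OF xs(1)]) (simp add: B_eq)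
  then show ?thesis
    unfolding lam_def using normal_mat_props(1)[OF dims(3) xs(1)] normal_mat_psd[OF dims(3) xs(1)] dims(1)
    by (intro psd_invertible_lambda_min_pos) auto
qed

lemma ss_min:
  defines "smin \<equiv> Min ((\<lambda>j. ss $ j) ` N)"
  shows "0 < smin" "\<And>j. j \<in> N \<Longrightarrow> smin \<le> ss $ j" "gam A b c ss = real n / smin"
proof -
  have fin: "finite ((\<lambda>j. ss $ j) ` N)"
    by (intro finite_imageI finite_subset[OF N_subset]) simp
  then have "smin \<in> (\<lambda>j. ss $ j) ` N"
    unfolding smin_def using N_nonempty by (intro Min_in) auto
  then show "0 < smin"
    by (auto simp: N_eq)
  show "smin \<le> ss $ j" if "j \<in> N" for j
    unfolding smin_def using fin that by (intro Min_le) auto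
  show "gam A b c ss = real n / smin"
    by (simp add: gam_def smin_def dims(7))
qed

lemma gam_pos: "0 < gam A b c ss"
  using ss_min dims(2) by simp

lemma imbalance_eq: "imbalance A b c = 1 + op_norm (colsub A N) / sigma"
  by (simp add: imbalance_def sigma_def)

lemma imbalance_pos: "0 < imbalance A b c"
  using op_norm_nonneg[OF colsub_carrier[OF dims(3) N_subset]] sigma_pos
  by (simp add: imbalance_eq add_pos_nonneg)

definition thr :: real where
  "thr = sqrt lam * \<tau> / (16 * gam A b c ss * op_norm A) * inverse (imbalance A b c)"

lemma thr_pos: "0 < thr"
  using lam_pos tau_pos gam_pos op_norm_pos imbalance_pos by (simp add: thr_def)

lemma kstar_eq: "kstar A b c xs ss \<tau> \<mu> = (LEAST k. 1 \<le> k \<and> \<mu> k \<le> thr)"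
  by (simp add: kstar_def thr_def lam_def)

text \<open>The \<open>LEAST\<close> in \<open>kstar\<close> is taken over a nonempty set: \<mu>
  decreases geometrically to 0, and the threshold is positive.\<close>

lemma kstar_props: "1 \<le> kstar A b c xs ss \<tau> \<mu>" "\<mu> (kstar A b c xs ss \<tau> \<mu>) \<le> thr"
  using mu_eventually_le[OF thr_pos] LeastI_ex[of "\<lambda>k. 1 \<le> k \<and> \<mu> k \<le> thr"]
  by (auto simp: kstar_eq)

section \<open>Distance of the iterates from the optimal solution\<close>

lemma iterate_dist:
  assumes k: "1 \<le> k"
  shows "vnorm (x k - xs) \<le> imbalance A b c * (2 * gam A b c ss * \<mu> k)"
proof -
  note xk = iterate(1)[OF k]
  note xkn = FpD(1)[OF xk]
  define xN where "xN = vec n (\<lambda>j. if j \<in> N then x k $ j else 0)"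
  \<comment> \<open>On N the optimal solution is 0, so \<open>xN\<close> is the whole of x_k - xs
    there and the remainder \<open>dB\<close> lives on B.\<close>
  define dB where "dB = x k - xs - xN"
  have xN: "xN \<in> carrier_vec n" "\<And>j. j < n \<Longrightarrow> j \<notin> N \<Longrightarrow> xN $ j = 0"
    by (auto simp: xN_def)
  have dB: "dB \<in> carrier_vec n" "\<And>j. j < n \<Longrightarrow> j \<notin> B \<Longrightarrow> dB $ j = 0"
    using xkn xs(1) xN(1) xs_off_B B_or_N by (auto simp: dB_def xN_def)
  obtain smin where smin: "0 < smin" "\<And>j. j \<in> N \<Longrightarrow> smin \<le> ss $ j" "gam A b c ss = real n / smin"
    using ss_min by blast
  \<comment> \<open>On N every entry of \<open>ss\<close> is at least \<open>smin\<close>, so the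
    product of \<open>ss\<close> with the iterate controls the sum of its N-coordinates; n / smin is
    \<gamma>.\<close>
  have "smin * (\<Sum>j\<in>{0..<n}. xN $ j) \<le> ss \<bullet> x k"
  proof -
    have "(\<Sum>j\<in>{0..<n}. smin * xN $ j) \<le> (\<Sum>j\<in>{0..<n}. ss $ j * x k $ j)"
    proof (rule sum_mono)
      fix j assume "j \<in> {0..<n}"
      then have j: "j < n" by simp
      have "0 \<le> x k $ j" "0 \<le> ss $ j"
        using FpD(3)[OF xk j] ss(2)[OF j] .
      then show "smin * xN $ j \<le> ss $ j * x k $ j"
        using j smin(2)[of j] by (auto simp: xN_def intro: mult_right_mono)
    qed
    then show ?thesis
      using xkn by (simp add: scalar_prod_def sum_distrib_left)
  qed
  also have "\<dots> \<le> 2 * real n * \<mu> k"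
    using ss_iterate[OF k] .
  finally have "(\<Sum>j\<in>{0..<n}. xN $ j) \<le> 2 * gam A b c ss * \<mu> k"
    using smin(1) by (simp add: smin(3) field_simps)
  moreover have "vnorm xN \<le> (\<Sum>j\<in>{0..<n}. xN $ j)"
    using vnorm_le_sum[of xN] FpD(3)[OF xk] by (simp add: xN_def)
  ultimately have norm_xN: "vnorm xN \<le> 2 * gam A b c ss * \<mu> k"
    by linarith
  have "A *\<^sub>v (x k - xs) = 0\<^sub>v m"
    using mult_minus_distrib_mat_vec[OF dims(3) xkn xs(1)] FpD(2)[OF xk] xs(2) dims(4) by simp
  \<comment> \<open>Both points satisfy the same equations, so the displacement on B has to
    compensate for the one on N.\<close>
  then have "A *\<^sub>v dB = - (A *\<^sub>v xN)"
    using mult_minus_distrib_mat_vec[OF dims(3) _ xN(1), of "x k - xs"] xkn xs(1) xN(1) dims(3)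
    unfolding dB_def by simp
  then have "vnorm (A *\<^sub>v dB) = vnorm (A *\<^sub>v xN)"
    by (simp add: vnorm_def)
  also have "\<dots> = vnorm (colsub A N *\<^sub>v subvec xN N)"
    using colsub_mult_subvec[OF dims(3) N_subset xN] by simp
  also have "\<dots> \<le> op_norm (colsub A N) * vnorm (subvec xN N)"
    using colsub_carrier[OF dims(3) N_subset] by (rule vnorm_mult_mat_le) (simp add: subvec_def)
  also have "vnorm (subvec xN N) = vnorm xN"
    using vnorm_subvec[OF dims(3) N_subset xN] .
  finally have "sigma * vnorm dB \<le> op_norm (colsub A N) * vnorm xN"
    using sigma_le[OF dB] by linarith
  then have norm_dB: "vnorm dB \<le> op_norm (colsub A N) / sigma * vnorm xN"
    using sigma_pos by (simp add: field_simps)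
  have "x k - xs = dB + xN"
    using xkn xs(1) xN(1) by (intro eq_vecI) (auto simp: dB_def)
  then have "vnorm (x k - xs) \<le> vnorm dB + vnorm xN"
    using vnorm_triangle[OF dB(1) xN(1)] by simp
  also have "\<dots> \<le> imbalance A b c * vnorm xN"
    using norm_dB by (simp add: imbalance_eq algebra_simps)
  also have "\<dots> \<le> imbalance A b c * (2 * gam A b c ss * \<mu> k)"
    using norm_xN imbalance_pos by (intro mult_left_mono) auto
  finally show ?thesis .
qed

lemma iterate_dist_thr:
  assumes k: "1 \<le> k" and le: "\<mu> k \<le> thr"
  shows "vnorm (x k - xs) * op_norm A \<le> sqrt lam / 8"
proof -
  have "vnorm (x k - xs) * op_norm A \<le> imbalance A b c * (2 * gam A b c ss * thr) * op_norm A"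
    using iterate_dist[OF k] le op_norm_pos imbalance_pos gam_pos
    by (intro mult_right_mono) (auto elim!: order_trans intro!: mult_left_mono)
  also have "\<dots> = \<tau> * (sqrt lam / 8)"
    using op_norm_pos imbalance_pos gam_pos by (simp add: thr_def field_simps)
  also have "\<dots> \<le> 1 * (sqrt lam / 8)"
    using tau_less_1 lam_pos by (intro mult_right_mono) auto
  finally show ?thesis by simp
qed

section \<open>Comparison of the normal matrices\<close>

lemma normal_mat_iterate_bounds:
  assumes k: "1 \<le> k" and le: "\<mu> k \<le> thr" and v: "v \<in> carrier_vec m"
  shows "v \<bullet> (normal_mat A (x k) *\<^sub>v v) \<le> (9 / 8)\<^sup>2 * (v \<bullet> (normal_mat A xs *\<^sub>v v))"
    and "(7 / 8)\<^sup>2 * (v \<bullet> (normal_mat A xs *\<^sub>v v)) \<le> v \<bullet> (normal_mat A (x k) *\<^sub>v v)"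
proof -
  define w where "w = transpose_mat A *\<^sub>v v"
  have w: "w \<in> carrier_vec n"
    using dims(3) v by (auto simp: w_def)
  have xk: "x k \<in> carrier_vec n"
    using FpD(1)[OF iterate(1)[OF k]] .
  define p q where "p = vnorm (diag_of (x k) *\<^sub>v w)" and "q = vnorm (diag_of xs *\<^sub>v w)"
  have carr: "diag_of u *\<^sub>v w \<in> carrier_vec n" if "u \<in> carrier_vec n" for u
    using diag_of_carrier[OF that] w by auto
  \<comment> \<open>The absolute error |u - u'| |A| |v| becomes an error relative to q because q
    \<ge> sqrt \<lambda> |v| for \<lambda> = \<open>lam\<close>. It is stated for general u and u'
    so that both orders of the difference can be used, one for each triangle inequality.\<close>
  have dist: "vnorm (diag_of (u - u') *\<^sub>v w) \<le> q / 8"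
    if u: "u \<in> carrier_vec n" "u' \<in> carrier_vec n" and le': "vnorm (u - u') * op_norm A \<le> sqrt lam / 8" for u u'
  proof -
    have "vnorm (diag_of (u - u') *\<^sub>v w) \<le> vnorm (u - u') * vnorm w"
      using u w abs_index_le_vnorm[of _ "u - u'"] by (intro vnorm_diag_mult_le) (auto simp: vnorm_nonneg)
    also have "\<dots> \<le> vnorm (u - u') * (op_norm A * vnorm v)"
      using vnorm_transpose_mult_le[OF dims(3) v] by (auto simp: w_def vnorm_nonneg intro: mult_left_mono)
    also have "\<dots> \<le> sqrt lam / 8 * vnorm v"
      using mult_right_mono[OF le' vnorm_nonneg[of v]] by (simp add: ac_simps)
    also have "sqrt lam * vnorm v \<le> q"
    proof (rule power2_le_imp_le)
      have "lam * (v \<bullet> v) \<le> v \<bullet> (normal_mat A xs *\<^sub>v v)"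
        unfolding lam_def using normal_mat_props(1,2)[OF dims(3) xs(1)] dims(1) v
        by (intro lambda_min_Rayleigh) auto
      then show "(sqrt lam * vnorm v)\<^sup>2 \<le> q\<^sup>2"
        using lam_pos normal_mat_props(3)[OF dims(3) xs(1) v]
        by (simp add: power_mult_distrib vnorm_power2 q_def w_def)
    qed (simp add: q_def vnorm_nonneg)
    then have "sqrt lam / 8 * vnorm v \<le> q / 8"
      by simp
    finally show ?thesis .
  qed
  have "vnorm (xs - x k) = vnorm (x k - xs)"
    using xk xs(1) by (auto simp: vnorm_def scalar_prod_def algebra_simps intro!: sum.cong)
  then have le': "vnorm (x k - xs) * op_norm A \<le> sqrt lam / 8" "vnorm (xs - x k) * op_norm A \<le> sqrt lam / 8"
    using iterate_dist_thr[OF k le] by auto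
  have "p \<le> q + vnorm (diag_of (x k - xs) *\<^sub>v w)"
    unfolding p_def q_def using vnorm_triangle[OF carr[OF xs(1)] carr[of "x k - xs"]] xk xs(1)
    by (simp add: diag_of_mult_split[OF xk xs(1) w])
  then have pq: "p \<le> 9 / 8 * q"
    using dist[OF xk xs(1) le'(1)] by simp
  have "q \<le> p + vnorm (diag_of (xs - x k) *\<^sub>v w)"
    unfolding p_def q_def using vnorm_triangle[OF carr[OF xk] carr[of "xs - x k"]] xk xs(1)
    by (simp add: diag_of_mult_split[OF xs(1) xk w])
  then have qp: "7 / 8 * q \<le> p"
    using dist[OF xs(1) xk le'(2)] by simp
  have nonneg: "0 \<le> p" "0 \<le> q"
    by (auto simp: p_def q_def vnorm_nonneg)
  have forms: "v \<bullet> (normal_mat A (x k) *\<^sub>v v) = p\<^sup>2" "v \<bullet> (normal_mat A xs *\<^sub>v v) = q\<^sup>2"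
    using normal_mat_props(3)[OF dims(3) xk v] normal_mat_props(3)[OF dims(3) xs(1) v]
    by (auto simp: p_def q_def w_def)
  show "v \<bullet> (normal_mat A (x k) *\<^sub>v v) \<le> (9 / 8)\<^sup>2 * (v \<bullet> (normal_mat A xs *\<^sub>v v))"
    unfolding forms power_mult_distrib[symmetric] using pq nonneg(1) by (rule power_mono)
  show "(7 / 8)\<^sup>2 * (v \<bullet> (normal_mat A xs *\<^sub>v v)) \<le> v \<bullet> (normal_mat A (x k) *\<^sub>v v)"
    unfolding forms power_mult_distrib[symmetric] using qp nonneg(2) by (intro power_mono) auto
qed

lemma kappa_iterates_le:
  assumes "kstar A b c xs ss \<tau> \<mu> \<le> k" "k \<le> j"
  shows "kappa (inv_sqrt (normal_mat A (x k)) * normal_mat A (x j) * inv_sqrt (normal_mat A (x k))) \<le> 9"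
proof -
  have k: "1 \<le> k" and j: "1 \<le> j"
    using assms kstar_props(1) by auto
  have mu: "\<mu> k \<le> thr" "\<mu> j \<le> thr"
    using assms mu_antimono[OF kstar_props(1)] kstar_props(2) by (meson order_trans)+
  note xk = FpD(1)[OF iterate(1)[OF k]] and xj = FpD(1)[OF iterate(1)[OF j]]
  have det: "det (normal_mat A (x k)) \<noteq> 0"
    using det_normal_mat[OF xk] iterate(2)[OF k] B_subset by fastforce
  \<comment> \<open>Both iterates are compared with the optimal solution; eliminating its form
    leaves the ratio of 7/8 to 9/8 and its reciprocal.\<close>
  have "(7 / 9)\<^sup>2 * (v \<bullet> (normal_mat A (x k) *\<^sub>v v)) \<le> v \<bullet> (normal_mat A (x j) *\<^sub>v v)"
    and "v \<bullet> (normal_mat A (x j) *\<^sub>v v) \<le> (9 / 7)\<^sup>2 * (v \<bullet> (normal_mat A (x k) *\<^sub>v v))"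
    if v: "v \<in> carrier_vec m" for v
    using normal_mat_iterate_bounds[OF k mu(1) v] normal_mat_iterate_bounds[OF j mu(2) v]
    by (simp_all add: power2_eq_square)
  then have "kappa (inv_sqrt (normal_mat A (x k)) * normal_mat A (x j) * inv_sqrt (normal_mat A (x k)))
      \<le> (9 / 7)\<^sup>2 / (7 / 9)\<^sup>2"
    using dims(1) normal_mat_props(1,2)[OF dims(3) xj]
    by (intro kappa_inv_sqrt_conjugate_le[OF normal_mat_props(1)[OF dims(3) xk]
          normal_mat_psd[OF dims(3) xk] det]) auto
  also have "\<dots> \<le> 9"
    by (simp add: power2_eq_square)
  finally show ?thesis .
qed

section \<open>The number of iterations\<close>

lemma kstar_le:
  assumes tau: "\<tau> = 1 / sqrt (2 * real n)"
    and E: "E = ln (\<mu> 1) + ln 16 + ln (sqrt (2 * real n)) + log_cond A b c xs ss"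
  shows "real (kstar A b c xs ss \<tau> \<mu>) \<le> 2 + sqrt (2 * real n) * max 0 E"
proof -
  define r where "r = sqrt (2 * real n)"
  have r: "0 < r"
    using dims(2) by (simp add: r_def)
  have tau_r: "\<tau> = 1 / r"
    by (simp add: tau r_def)
  define Q where "Q = gam A b c ss * op_norm A / sqrt lam"
  have Q: "0 < Q"
    using gam_pos op_norm_pos lam_pos by (simp add: Q_def)
  \<comment> \<open>E is the logarithm of \<mu>_1 divided by the threshold. As (1 - \<tau>)^l \<le>
    exp (-\<tau> l) and \<tau> = 1/r, about r E reductions suffice.\<close>
  have "exp E = \<mu> 1 * 16 * r * (Q * imbalance A b c)"
    using mu_1_pos r Q imbalance_pos
    by (simp add: E log_cond_def exp_add flip: r_def lam_def Q_def)
  moreover have "thr = 1 / (16 * r * (Q * imbalance A b c))"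
  proof -
    have "thr = sqrt lam * (1 / r) / (16 * gam A b c ss * op_norm A) * inverse (imbalance A b c)"
      unfolding thr_def by (simp add: tau_r)
    then show ?thesis
      using gam_pos op_norm_pos lam_pos imbalance_pos r by (simp add: Q_def field_simps)
  qed
  ultimately have thr: "thr = \<mu> 1 * exp (- E)"
    using mu_1_pos r Q imbalance_pos by (simp add: exp_minus field_simps)
  \<comment> \<open>A negative E means that \<mu>_1 is already below the threshold;
    \<open>nat\<close> then gives l = 0, which is where the maximum with 0 in the bound comes
    from.\<close>
  define l where "l = nat \<lceil>r * E\<rceil>"
  have "r * E \<le> real l"
    unfolding l_def by linarith
  then have "E \<le> \<tau> * real l"
    using r by (simp add: tau_r field_simps)
  have "\<mu> (Suc l) = (1 - \<tau>) ^ l * \<mu> 1"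
    using mu_eq[of "Suc l"] by simp
  also have "\<dots> \<le> exp (- \<tau>) ^ l * \<mu> 1"
    using tau_less_1 mu_1_pos exp_ge_add_one_self[of "- \<tau>"] by (intro mult_right_mono power_mono) auto
  also have "\<dots> = exp (- (\<tau> * real l)) * \<mu> 1"
    by (simp add: mult.commute flip: exp_of_nat_mult)
  also have "\<dots> \<le> exp (- E) * \<mu> 1"
    using \<open>E \<le> \<tau> * real l\<close> mu_1_pos by (intro mult_right_mono) auto
  finally have "\<mu> (Suc l) \<le> thr"
    by (simp add: thr mult.commute)
  \<comment> \<open>Indices start at 1, so l reductions lead to index l + 1. Together with the
    rounding up of r E this accounts for the additive 2.\<close>
  then have "kstar A b c xs ss \<tau> \<mu> \<le> Suc l"
    unfolding kstar_eq by (intro Least_le) simp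
  moreover have "real l \<le> 1 + r * max 0 E"
  proof (cases "0 \<le> E")
    case True
    then have "0 \<le> r * E"
      using r by simp
    then show ?thesis
      unfolding l_def using True by (simp add: max_absorb2) linarith
  next
    case False
    then have "r * E \<le> 0"
      using r by (simp add: mult_nonneg_nonpos)
    then show ?thesis
      unfolding l_def using False by simp
  qed
  ultimately show ?thesis
    by (simp flip: r_def)
qed

text \<open>In units of K L, where L is \<open>log_cond\<close>, the logarithm of \<mu>_1 costs 1,
  ln 16 costs 4 and half the logarithm of 2n costs 1, so E \<le> (6 K + 1) L. The factor sqrt (2 n)
  \<le> 2 sqrt n doubles this to 12 K + 2, and the additive 2, at most 2 sqrt n K L, raises it to 14
  K + 2.\<close>

lemma kstar_O:
  assumes tau: "\<tau> = 1 / sqrt (2 * real n)" and K: "0 < K"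
    and range: "O_range K n (\<mu> 1) (log_cond A b c xs ss)"
  shows "real (kstar A b c xs ss \<tau> \<mu>) \<le> (14 * K + 2) * sqrt (real n) * log_cond A b c xs ss"
proof -
  define L where "L = log_cond A b c xs ss"
  have L: "1 \<le> K * L" "ln (real n) \<le> K * L" "ln (\<mu> 1) \<le> K * L"
    using range by (auto simp: O_range_def L_def)
  have "0 < L"
    using zero_less_mult_pos[of K L] L(1) K by simp
  define E where "E = ln (\<mu> 1) + ln 16 + ln (sqrt (2 * real n)) + L"
  have "ln (16 :: real) = 4 * ln 2"
    using ln_realpow[of 2 4] by simp
  then have "ln (16 :: real) \<le> 4 * (K * L)"
    using ln_2_less_1 L(1) by linarith
  moreover have "ln (sqrt (2 * real n)) = (ln 2 + ln (real n)) / 2"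
    using dims(2) by (simp add: ln_sqrt ln_mult)
  moreover have "ln 2 + ln (real n) \<le> K * L + K * L"
    using ln_2_less_1 L(1,2) by (intro add_mono) simp_all
  ultimately have "E \<le> K * L + 4 * (K * L) + (K * L + K * L) / 2 + L"
    using L(3) unfolding E_def by (intro add_mono) auto
  then have "E \<le> (6 * K + 1) * L"
    by (simp add: algebra_simps)
  moreover have "0 \<le> (6 * K + 1) * L"
    using K \<open>0 < L\<close> by simp
  ultimately have E: "max 0 E \<le> (6 * K + 1) * L"
    by simp
  have n: "1 \<le> sqrt (real n)"
    using dims(2) by simp
  have "sqrt 2 \<le> (2 :: real)"
    using real_sqrt_le_mono[of 2 4] by simp
  then have "sqrt (2 * real n) \<le> 2 * sqrt (real n)"
    by (simp add: real_sqrt_mult mult_right_mono)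
  then have "sqrt (2 * real n) * max 0 E \<le> 2 * sqrt (real n) * ((6 * K + 1) * L)"
    using E by (intro mult_mono) auto
  moreover have "1 * 1 \<le> sqrt (real n) * (K * L)"
    using n L(1) by (intro mult_mono) auto
  ultimately have "2 + sqrt (2 * real n) * max 0 E \<le> (14 * K + 2) * sqrt (real n) * L"
    by (simp add: algebra_simps)
  then show ?thesis
    using kstar_le[OF tau, of E] by (simp add: E_def L_def)
qed

end

theorem theorem3p2:
  shows "(\<forall>m n A b c xs ss \<tau> x \<mu>.
            ipm_run m n A b c xs ss \<tau> x \<mu> \<and> \<tau> \<le> 1 / sqrt (2 * real n) \<longrightarrow>
            (\<forall>k j. kstar A b c xs ss \<tau> \<mu> \<le> k \<and> k \<le> j \<longrightarrow>
               kappa (inv_sqrt (normal_mat A (x k)) * normal_mat A (x j)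
                        * inv_sqrt (normal_mat A (x k))) \<le> 9))
       \<and> (\<forall>K > 0. \<exists>C. \<forall>m n A b c xs ss \<tau> x \<mu>.
            ipm_run m n A b c xs ss \<tau> x \<mu> \<and> \<tau> = 1 / sqrt (2 * real n)
              \<and> O_range K n (\<mu> 1) (log_cond A b c xs ss) \<longrightarrow>
            real (kstar A b c xs ss \<tau> \<mu>) \<le> C * sqrt (real n) * log_cond A b c xs ss)"
proof (intro conjI allI impI)
  fix m n A b c xs ss \<tau> x \<mu> k j
  assume run: "ipm_run m n A b c xs ss \<tau> x \<mu> \<and> \<tau> \<le> 1 / sqrt (2 * real n)"
    and kj: "kstar A b c xs ss \<tau> \<mu> \<le> k \<and> k \<le> j"
  interpret primal_ipm_run m n A b c xs ss \<tau> x \<mu>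
    using run by unfold_locales simp
  show "kappa (inv_sqrt (normal_mat A (x k)) * normal_mat A (x j) * inv_sqrt (normal_mat A (x k))) \<le> 9"
    using kj by (intro kappa_iterates_le) auto
next
  fix K :: real assume "0 < K"
  then show "\<exists>C. \<forall>m n A b c xs ss \<tau> x \<mu>.
            ipm_run m n A b c xs ss \<tau> x \<mu> \<and> \<tau> = 1 / sqrt (2 * real n)
              \<and> O_range K n (\<mu> 1) (log_cond A b c xs ss) \<longrightarrow>
            real (kstar A b c xs ss \<tau> \<mu>) \<le> C * sqrt (real n) * log_cond A b c xs ss"
    by (intro exI[of _ "14 * K + 2"]) (blast intro: primal_ipm_run.kstar_O primal_ipm_run.intro)
qed

end
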